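(* Let $1\le q,r\le\infty$, $\alpha\ge0$, and let $\mathcal G=(V,E)$ be a connected simple graph with Beurling dimension $d$ and density $D_1(\mathcal G)$. Then the following hold. (i) $\mathcal B_{1,0}(\mathcal G)\subset\mathcal S\subset\mathcal B(\ell^q)$ and $$\|A\|_{\mathcal B(\ell^q)}\le\|A\|_{\mathcal S}\le d\,D_1(\mathcal G)\,\|A\|_{\mathcal B_{1,0}}\quad\text{for all }A\in\mathcal B_{1,0}(\mathcal G).$$ (ii) For all $r''\ge r$, $\gamma\ge\alpha$ and $\beta>\gamma+d(1/r-1/r'')$, $\mathcal B_{r'',\beta}(\mathcal G)\subset\mathcal B_{r,\gamma}(\mathcal G)\subset\mathcal B_{r,\alpha}(\mathcal G)\subset\mathcal B_{r'',\alpha}(\mathcal G)$, and $$\|A\|_{\mathcal B_{r'',\alpha}}\le\|A\|_{\mathcal B_{r,\alpha}}\le\|A\|_{\mathcal B_{r,\gamma}}\le\Big(\frac{\beta-\gamma-(d-1)(1/r-1/r'')}{\beta-\gamma-d(1/r-1/r'')}\Big)^{1/r-1/r''}\|A\|_{\mathcal B_{r'',\beta}}$$ for all $A\in\mathcal B_{r'',\beta}(\mathcal G)$. (iii) If $\alpha>d(1-1/r)$, then $\mathcal B_{r,\alpha}(\mathcal G)$ is a Banach algebra, and $$\|AB\|_{\mathcal B_{r,\alpha}}\le2^{\alpha+d/r}\big(\|B\|_{\mathcal S}\|A\|_{\mathcal B_{r,\alpha}}+\|A\|_{\mathcal S}\|B\|_{\mathcal B_{r,\alpha}}\big)\le2^{\alpha+1+d/r}d\,D_1(\mathcal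 G)\Big(\frac{\alpha-(d-1)(1-1/r)}{\alpha-d(1-1/r)}\Big)^{1-1/r}\|A\|_{\mathcal B_{r,\alpha}}\|B\|_{\mathcal B_{r,\alpha}}$$ for all $A,B\in\mathcal B_{r,\alpha}(\mathcal G)$. (iv) $\mathcal B_{r,\alpha}(\mathcal G)$ is solid for $\alpha\ge0$: if $A=(a(\lambda,\lambda'))_{\lambda,\lambda'\in V}$ and $B=(b(\lambda,\lambda'))_{\lambda,\lambda'\in V}$ satisfy $|a(\lambda,\lambda')|\le|b(\lambda,\lambda')|$ for all $\lambda,\lambda'\in V$, then $\|A\|_{\mathcal B_{r,\alpha}}\le\|B\|_{\mathcal B_{r,\alpha}}$.
   Context: A simple graph is an unweighted, undirected graph without loops or multiple edges. For a connected simple graph $\mathcal G=(V,E)$, $\rho(\lambda,\lambda')$ is the geodesic distance on $V$ (number of edges in a shortest path), $B(\lambda,R)=\{\lambda'\in V:\rho(\lambda,\lambda')\le R\}$, and $\mu$ is the counting measure on $V$. It has polynomial growth if there are positive constants $D_1(\mathcal G)$ and $d$ with $\mu(B(\lambda,R))\le D_1(\mathcal G)(R+1)^d$ for all $\lambda\in V$, $R\ge0$; the minimal constants $d$ and $D_1(\mathcal G)$ are called the Beurling dimension and density of $\mathcal G$. For a matrix $A=(a(\lambda,\lambda'))_{\lambda,\lambda'\in V}$ put $h_A(n)=\sup_{\rho(\lambda,\lambda')\ge n}|a(\lambda,\lambda')|$, $n\ge0$. For $1\le r\le\infty$, $\alpha\ge0$, $$\|A\|_{\mathcal B_{r,\alpha}}=\Big(\sum_{n=0}^\infty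 h_A(n)^r(n+1)^{\alpha r+d-1}\Big)^{1/r}\ (1\le r<\infty),\qquad \|A\|_{\mathcal B_{\infty,\alpha}}=\sup_{n\ge0}h_A(n)(n+1)^\alpha,$$ and $\mathcal B_{r,\alpha}(\mathcal G)$ is the set of all $A$ with $\|A\|_{\mathcal B_{r,\alpha}}<\infty$. The Schur norm is $\|A\|_{\mathcal S}=\max\big(\sup_{\lambda}\sum_{\lambda'}|a(\lambda,\lambda')|,\ \sup_{\lambda'}\sum_{\lambda}|a(\lambda,\lambda')|\big)$, and $\mathcal S$ is the set of matrices with finite Schur norm. $\mathcal B(\ell^q)$ is the algebra of bounded operators on $\ell^q(V)$ with operator norm. "Banach algebra" is understood with the norm being submultiplicative up to a multiplicative constant. Convention: $1/\infty=0$. *)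

theory Defs
  imports "HOL-Analysis.Analysis" "HOL-Library.Function_Algebras"
begin

section \<open>Simple graphs, geodesic distance, Beurling dimension and density\<close>

text \<open>Edges are unordered: an edge between u and v is represented by both pairs
  (u, v) and (v, u). The vertex set may be infinite.\<close>

definition simple_graph :: "'v set \<Rightarrow> ('v \<times> 'v) set \<Rightarrow> bool" where
  "simple_graph V E \<longleftrightarrow> E \<subseteq> V \<times> V \<and> sym E \<and> irrefl E"

definition connected_graph :: "'v set \<Rightarrow> ('v \<times> 'v) set \<Rightarrow> bool" where
  "connected_graph V E \<longleftrightarrow> (\<forall>x\<in>V. \<forall>y\<in>V. (x, y) \<in> E\<^sup>*)"

text \<open>The pair (x, y) is in the n-th relational power of E iff x and y are joined by a walk
  with n edges. A walk of minimal length is a path, so the least such n is the number of edges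
  of a shortest path. The value is meaningful only for vertices that can be joined.\<close>

definition geodesic_dist :: "('v \<times> 'v) set \<Rightarrow> 'v \<Rightarrow> 'v \<Rightarrow> nat" where
  "geodesic_dist E x y = (LEAST n. (x, y) \<in> E ^^ n)"

definition graph_ball :: "'v set \<Rightarrow> ('v \<times> 'v) set \<Rightarrow> 'v \<Rightarrow> real \<Rightarrow> 'v set" where
  "graph_ball V E x R = {y \<in> V. real (geodesic_dist E x y) \<le> R}"

definition polynomial_growth :: "'v set \<Rightarrow> ('v \<times> 'v) set \<Rightarrow> real \<Rightarrow> real \<Rightarrow> bool" where
  "polynomial_growth V E D d \<longleftrightarrow> 0 < D \<and> 0 < d \<and>
     (\<forall>x\<in>V. \<forall>R\<ge>0. emeasure (count_space V) (graph_ball V E x R) \<le> ennreal (D * (R + 1) powr d))"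

text \<open>The dimension is an attained minimum among positive exponents. Having a Beurling dimension
  is thus an assumption on the graph; in particular, finite graphs have none.\<close>

definition beurling_dimension :: "'v set \<Rightarrow> ('v \<times> 'v) set \<Rightarrow> real \<Rightarrow> bool" where
  "beurling_dimension V E d \<longleftrightarrow>
     (\<exists>D. polynomial_growth V E D d) \<and> (\<forall>D' d'. polynomial_growth V E D' d' \<longrightarrow> d \<le> d')"

definition beurling_density :: "'v set \<Rightarrow> ('v \<times> 'v) set \<Rightarrow> real \<Rightarrow> real \<Rightarrow> bool" where
  "beurling_density V E d D \<longleftrightarrow>
     beurling_dimension V E d \<and> polynomial_growth V E D d \<and>
     (\<forall>D'. polynomial_growth V E D' d \<longrightarrow> D \<le> D')"

section \<open>Matrices and their norms\<close>

text \<open>Norms take values in \<^typ>\<open>ennreal\<close>, so that being in a space means having finite norm.\<close>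

text \<open>Used with positive real exponents only.\<close>

definition ennpowr :: "ennreal \<Rightarrow> real \<Rightarrow> ennreal" where
  "ennpowr x p = (if x = \<infinity> then \<infinity> else ennreal (enn2real x powr p))"

text \<open>The reciprocal of an exponent in [1, infinity], with value 0 at infinity.\<close>

definition recip :: "ennreal \<Rightarrow> real" where
  "recip p = enn2real (1 / p)"

text \<open>A complex matrix indexed by V is a function on the whole type vanishing outside
  V \<open>\<times>\<close> V, so that equality of functions is equality of matrices. Vectors are treated
  likewise. Sums and differences are the pointwise ones of Function_Algebras.\<close>

definition matrices :: "'v set \<Rightarrow> ('v \<Rightarrow> 'v \<Rightarrow> complex) set" where
  "matrices V = {A. \<forall>x y. x \<notin> V \<or> y \<notin> V \<longrightarrow> A x y = 0}"

definition mat_scale :: "complex \<Rightarrow> ('v \<Rightarrow> 'v \<Rightarrow> complex) \<Rightarrow> ('v \<Rightarrow> 'v \<Rightarrow> complex)" where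
  "mat_scale c A = (\<lambda>x y. c * A x y)"

definition mat_mult ::
    "'v set \<Rightarrow> ('v \<Rightarrow> 'v \<Rightarrow> complex) \<Rightarrow> ('v \<Rightarrow> 'v \<Rightarrow> complex) \<Rightarrow> ('v \<Rightarrow> 'v \<Rightarrow> complex)" where
  "mat_mult V A B = (\<lambda>x y. \<Sum>\<^sub>\<infinity>z\<in>V. A x z * B z y)"

definition mat_op :: "'v set \<Rightarrow> ('v \<Rightarrow> 'v \<Rightarrow> complex) \<Rightarrow> ('v \<Rightarrow> complex) \<Rightarrow> ('v \<Rightarrow> complex)" where
  "mat_op V A f = (\<lambda>x. \<Sum>\<^sub>\<infinity>y\<in>V. A x y * f y)"

definition off_diag_sup ::
    "'v set \<Rightarrow> ('v \<times> 'v) set \<Rightarrow> ('v \<Rightarrow> 'v \<Rightarrow> complex) \<Rightarrow> nat \<Rightarrow> ennreal" where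
  "off_diag_sup V E A n =
     (SUP (x, y) \<in> {(x, y). x \<in> V \<and> y \<in> V \<and> n \<le> geodesic_dist E x y}. ennreal (cmod (A x y)))"

definition beurling_norm ::
    "'v set \<Rightarrow> ('v \<times> 'v) set \<Rightarrow> real \<Rightarrow> ennreal \<Rightarrow> real \<Rightarrow> ('v \<Rightarrow> 'v \<Rightarrow> complex) \<Rightarrow> ennreal" where
  "beurling_norm V E d r \<alpha> A =
     (if r = \<infinity> then (SUP n. off_diag_sup V E A n * ennreal ((real n + 1) powr \<alpha>))
      else ennpowr (\<Sum>n. ennpowr (off_diag_sup V E A n) (enn2real r)
                        * ennreal ((real n + 1) powr (\<alpha> * enn2real r + d - 1)))
                   (recip r))"

definition beurling_class ::
    "'v set \<Rightarrow> ('v \<times> 'v) set \<Rightarrow> real \<Rightarrow> ennreal \<Rightarrow> real \<Rightarrow> ('v \<Rightarrow> 'v \<Rightarrow> complex) set" where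
  "beurling_class V E d r \<alpha> = {A \<in> matrices V. beurling_norm V E d r \<alpha> A < \<infinity>}"

definition schur_norm :: "'v set \<Rightarrow> ('v \<Rightarrow> 'v \<Rightarrow> complex) \<Rightarrow> ennreal" where
  "schur_norm V A = max (SUP x\<in>V. \<Sum>\<^sub>\<infinity>y\<in>V. ennreal (cmod (A x y)))
                        (SUP y\<in>V. \<Sum>\<^sub>\<infinity>x\<in>V. ennreal (cmod (A x y)))"

definition schur_class :: "'v set \<Rightarrow> ('v \<Rightarrow> 'v \<Rightarrow> complex) set" where
  "schur_class V = {A \<in> matrices V. schur_norm V A < \<infinity>}"

section \<open>Bounded operators on sequence spaces\<close>

definition lq_norm :: "'v set \<Rightarrow> ennreal \<Rightarrow> ('v \<Rightarrow> complex) \<Rightarrow> ennreal" where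
  "lq_norm V q f =
     (if q = \<infinity> then (SUP x\<in>V. ennreal (cmod (f x)))
      else ennpowr (\<Sum>\<^sub>\<infinity>x\<in>V. ennreal (cmod (f x) powr enn2real q)) (recip q))"

definition lq_space :: "'v set \<Rightarrow> ennreal \<Rightarrow> ('v \<Rightarrow> complex) set" where
  "lq_space V q = {f. (\<forall>x. x \<notin> V \<longrightarrow> f x = 0) \<and> lq_norm V q f < \<infinity>}"

definition bounded_ops :: "'v set \<Rightarrow> ennreal \<Rightarrow> (('v \<Rightarrow> complex) \<Rightarrow> ('v \<Rightarrow> complex)) set" where
  "bounded_ops V q = {T.
     (\<forall>f\<in>lq_space V q. T f \<in> lq_space V q) \<and>
     (\<forall>f\<in>lq_space V q. \<forall>g\<in>lq_space V q. T (f + g) = T f + T g) \<and>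
     (\<forall>c. \<forall>f\<in>lq_space V q. T (\<lambda>x. c * f x) = (\<lambda>x. c * T f x)) \<and>
     (\<exists>C::real. \<forall>f\<in>lq_space V q. lq_norm V q (T f) \<le> ennreal C * lq_norm V q f)}"

definition op_norm :: "'v set \<Rightarrow> ennreal \<Rightarrow> (('v \<Rightarrow> complex) \<Rightarrow> ('v \<Rightarrow> complex)) \<Rightarrow> ennreal" where
  "op_norm V q T = (SUP f \<in> {f \<in> lq_space V q. lq_norm V q f \<le> 1}. lq_norm V q (T f))"

text \<open>The matrices that define a bounded operator. Since \<^const>\<open>infsum\<close> is 0 for divergent sums,
  convergence of the sums defining the operator is required explicitly.\<close>

definition bounded_op_matrices :: "'v set \<Rightarrow> ennreal \<Rightarrow> ('v \<Rightarrow> 'v \<Rightarrow> complex) set" where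
  "bounded_op_matrices V q = {A \<in> matrices V.
     (\<forall>f\<in>lq_space V q. \<forall>x\<in>V. (\<lambda>y. A x y * f y) summable_on V) \<and>
     mat_op V A \<in> bounded_ops V q}"

section \<open>Banach algebras\<close>

text \<open>A not necessarily unital complex Banach algebra carried by a subset S of a vector space.
  The norm is submultiplicative only up to a constant.\<close>

definition banach_algebra_on ::
    "'a::ab_group_add set \<Rightarrow> (complex \<Rightarrow> 'a \<Rightarrow> 'a) \<Rightarrow> ('a \<Rightarrow> 'a \<Rightarrow> 'a) \<Rightarrow> ('a \<Rightarrow> real) \<Rightarrow> bool" where
  "banach_algebra_on S smul mul nrm \<longleftrightarrow>
     vector_space smul \<and> module.subspace smul S \<and>
     \<comment> \<open>associative bilinear multiplication\<close>
     (\<forall>a\<in>S. \<forall>b\<in>S. mul a b \<in> S) \<and>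
     (\<forall>a\<in>S. \<forall>b\<in>S. \<forall>c\<in>S. mul (mul a b) c = mul a (mul b c)) \<and>
     (\<forall>a\<in>S. \<forall>b\<in>S. \<forall>c\<in>S. mul (a + b) c = mul a c + mul b c \<and>
                          mul a (b + c) = mul a b + mul a c) \<and>
     (\<forall>t. \<forall>a\<in>S. \<forall>b\<in>S. mul (smul t a) b = smul t (mul a b) \<and>
                       mul a (smul t b) = smul t (mul a b)) \<and>
     \<comment> \<open>complete norm\<close>
     (\<forall>a\<in>S. 0 \<le> nrm a \<and> (nrm a = 0 \<longleftrightarrow> a = 0)) \<and>
     (\<forall>a\<in>S. \<forall>b\<in>S. nrm (a + b) \<le> nrm a + nrm b) \<and>
     (\<forall>t. \<forall>a\<in>S. nrm (smul t a) = cmod t * nrm a) \<and>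
     Metric_space.mcomplete S (\<lambda>a b. nrm (a - b)) \<and>
     (\<exists>K. \<forall>a\<in>S. \<forall>b\<in>S. nrm (mul a b) \<le> K * nrm a * nrm b)"

end

theory Submission
  imports Defs
begin

text \<open>All norms in question depend on a matrix only through its decreasing sequence h of off-diagonal
  suprema, so the inclusions are statements about weighted \<open>\<ell>\<^sup>r\<close> norms of h: the weights
  \<open>(n + 1)\<^bsup>d - 1\<^esup>\<close> are at least 1 because balls of an infinite connected graph grow at least linearly,
  which gives one inclusion, and Hoelder's inequality with
  \<open>\<Sum>\<^sub>n (n + 1)\<^bsup>- s\<^esup> \<le> s / (s - 1)\<close> gives the other. Summation by parts along the spheres around a
  vertex bounds the Schur norm by the sum of \<open>h n * ((n + 1)\<^bsup>d\<^esup> - n\<^bsup>d\<^esup>)\<close>. In a product the entry at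
  distance n sees only pairs of steps one of which has length at least n / 2, so h of the product is at
  most a sum of Schur norms times h at n / 2; halving the index costs the factor
  \<open>2\<^bsup>\<alpha> + d / r\<^esup>\<close>. Completeness is Fatou's lemma applied to h.\<close>

section \<open>Powers and unordered sums of extended nonnegative reals\<close>

text \<open>Growth controls balls only; a single sphere may be nearly as large as the bound for the
  whole ball. Monotonicity of h is what allows ball sizes to be replaced by their bounds under the
  sum, and the mean value theorem then turns the increment of the d-th power into
  \<open>d * (n + 1) powr (d - 1)\<close>: this is the origin of the constant d D. The factor
  \<open>2 powr (\<alpha> + d / r)\<close> has three sources: \<open>2 powr \<alpha>\<close> from
  the weight, \<open>2 powr ((d - 1) / r)\<close> from the measure, and
  \<open>2 powr (1 / r)\<close> because halving is two-to-one. In the embedding put \<delta> = 1/r -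
  1/r''. For \<delta> > 0, Hoelder's inequality leaves the sum of \<open>(n + 1) powr - s\<close>
  with s = (\<beta> - \<gamma>)/\<delta> - d + 1; the condition s > 1 is exactly the hypothesis on
  \<beta>, and s/(s - 1) is exactly the quotient in the statement. Norms may be infinite, so the
  classical inequalities are proved in [0, \<infinity>]. One weighted Jensen inequality, obtained
  from Young's, yields Hoelder's inequality, Minkowski's inequality and the Schur test.\<close>

lemma ennpowr_ennreal: "0 \<le> x \<Longrightarrow> ennpowr (ennreal x) p = ennreal (x powr p)"
  by (simp add: ennpowr_def)

lemma ennpowr_top [simp]: "ennpowr top p = top"
  by (simp add: ennpowr_def)

lemma ennpowr_0 [simp]: "ennpowr 0 p = 0"
  by (simp add: ennpowr_def)

lemma ennpowr_one [simp]: "ennpowr x 1 = x"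
  by (cases x) (auto simp: ennpowr_ennreal)

lemma ennpowr_eq_0_iff [simp]: "ennpowr x p = 0 \<longleftrightarrow> x = 0"
  by (cases x) (auto simp: ennpowr_ennreal)

lemma ennpowr_eq_top_iff [simp]: "ennpowr x p = top \<longleftrightarrow> x = top"
  by (cases x) (auto simp: ennpowr_ennreal)

text \<open>The values 0 and \<infinity> are fixed by \<open>ennpowr\<close> for exponents of any
  sign, including 0. The power laws are therefore identities for all real exponents, and only
  monotonicity asks for a positive one.\<close>

lemma ennpowr_powr: "ennpowr (ennpowr x a) b = ennpowr x (a * b)"
  by (cases x) (auto simp: ennpowr_ennreal powr_powr)

lemma ennpowr_mult: "ennpowr (x * y) p = ennpowr x p * ennpowr y p"
proof -
  consider "x = 0 \<or> y = 0" | "x \<noteq> 0" "y \<noteq> 0" "x = top \<or> y = top"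
    | "x \<noteq> top" "y \<noteq> top"
    by blast
  then show ?thesis
  proof cases
    case 2
    then show ?thesis
      by (auto simp: ennreal_top_mult ennreal_mult_top)
  next
    case 3
    then show ?thesis
      by (cases x; cases y)
        (auto simp: ennpowr_ennreal powr_mult ennreal_mult simp flip: ennreal_mult)
  qed auto
qed

lemma ennpowr_add: "ennpowr x (a + b) = ennpowr x a * ennpowr x b"
  by (cases x) (auto simp: ennpowr_ennreal powr_add ennreal_mult)

lemma ennpowr_mono:
  assumes "0 < p" "x \<le> y"
  shows "ennpowr x p \<le> ennpowr y p"
  using assms
  by (cases x; cases y) (auto simp: ennpowr_ennreal top_unique intro: powr_mono2)

text \<open>For positive p the power is an order automorphism of [0, \<infinity>] with inverse the
  power 1/p. In this form it moves the outer root of a norm to the other side of an inequality;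
  compatibility with suprema follows from it too.\<close>

lemma ennpowr_le_iff_left:
  assumes "0 < p"
  shows "ennpowr x (1 / p) \<le> y \<longleftrightarrow> x \<le> ennpowr y p"
  using ennpowr_mono[of p "ennpowr x (1 / p)" y] ennpowr_mono[of "1 / p" x "ennpowr y p"] assms
  by (auto simp: ennpowr_powr)

lemma ennpowr_le_iff_right:
  assumes "0 < p"
  shows "ennpowr x p \<le> y \<longleftrightarrow> x \<le> ennpowr y (1 / p)"
  using ennpowr_le_iff_left[of "1 / p" x y] assms by simp

lemma ennpowr_le_cancel:
  assumes "0 < p"
  shows "ennpowr x p \<le> ennpowr y p \<longleftrightarrow> x \<le> y"
  using ennpowr_le_iff_right[OF assms, of x "ennpowr y p"] assms by (simp add: ennpowr_powr)

lemma ennpowr_SUP: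
  assumes "0 < p"
  shows "ennpowr (SUP i\<in>I. f i) p = (SUP i\<in>I. ennpowr (f i) p)"
proof (rule antisym)
  have "f i \<le> ennpowr (SUP i\<in>I. ennpowr (f i) p) (1 / p)" if "i \<in> I" for i
    using that assms by (auto simp flip: ennpowr_le_iff_right intro: SUP_upper)
  then show "ennpowr (SUP i\<in>I. f i) p \<le> (SUP i\<in>I. ennpowr (f i) p)"
    using assms by (auto simp: ennpowr_le_iff_right intro: SUP_least)
qed (use assms in \<open>auto intro!: SUP_least ennpowr_mono SUP_upper\<close>)

section \<open>Unordered sums in [0, \<infinity>]: comparison, additivity and interchange\<close>

lemma infsum_eq_suminf_ennreal: "(\<Sum>\<^sub>\<infinity>n\<in>UNIV. f n) = (\<Sum>n. f n :: ennreal)"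
  by (intro sums_unique has_sum_imp_sums has_sum_infsum nonneg_summable_on_complete) simp

lemma sum_le_infsum_ennreal:
  "finite F \<Longrightarrow> F \<subseteq> A \<Longrightarrow> sum f F \<le> infsum (f :: 'a \<Rightarrow> ennreal) A"
  by (subst nonneg_infsum_complete) (auto intro!: SUP_upper)

lemma infsum_ennreal_least:
  "(\<And>F. finite F \<Longrightarrow> F \<subseteq> A \<Longrightarrow> sum f F \<le> c) \<Longrightarrow> infsum (f :: 'a \<Rightarrow> ennreal) A \<le> c"
  by (subst nonneg_infsum_complete) (auto intro!: SUP_least)

lemma le_infsum_ennreal: "x \<in> A \<Longrightarrow> f x \<le> infsum (f :: 'a \<Rightarrow> ennreal) A"
  using sum_le_infsum_ennreal[of "{x}" A f] by simp

lemma infsum_ennreal_eq_0_iff: "infsum (f :: 'a \<Rightarrow> ennreal) A = 0 \<longleftrightarrow> (\<forall>x\<in>A. f x = 0)"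
  using le_infsum_ennreal[of _ A f] by (auto intro!: infsum_0)

lemma infsum_mono_ennreal:
  "(\<And>x. x \<in> A \<Longrightarrow> f x \<le> g x) \<Longrightarrow> infsum (f :: 'a \<Rightarrow> ennreal) A \<le> infsum g A"
  by (intro infsum_mono nonneg_summable_on_complete) auto

lemma infsum_cmult_ennreal: "(\<Sum>\<^sub>\<infinity>x\<in>A. c * f x) = c * (\<Sum>\<^sub>\<infinity>x\<in>A. f x :: ennreal)"
  by (simp add: nonneg_infsum_complete SUP_mult_left_ennreal flip: sum_distrib_left)

lemma infsum_add_ennreal:
  "(\<Sum>\<^sub>\<infinity>x\<in>A. f x + g x) = (\<Sum>\<^sub>\<infinity>x\<in>A. f x) + (\<Sum>\<^sub>\<infinity>x\<in>A. g x :: ennreal)"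
  by (intro infsum_add nonneg_summable_on_complete) auto

text \<open>Tonelli's theorem for index sets of any cardinality. A finite part of the outer sum
  commutes with the inner sum by additivity, and the supremum over finite parts is bounded by the
  other iterated sum; equality follows by symmetry.\<close>

lemma infsum_swap_le_ennreal:
  "(\<Sum>\<^sub>\<infinity>x\<in>A. \<Sum>\<^sub>\<infinity>y\<in>B. f x y) \<le> (\<Sum>\<^sub>\<infinity>y\<in>B. \<Sum>\<^sub>\<infinity>x\<in>A. f x y :: ennreal)"
proof (rule infsum_ennreal_least)
  fix F assume F: "finite F" "F \<subseteq> A"
  have "(\<Sum>x\<in>F. \<Sum>\<^sub>\<infinity>y\<in>B. f x y) = (\<Sum>\<^sub>\<infinity>y\<in>B. \<Sum>x\<in>F. f x y)"
    using F(1) by (induction F rule: finite_induct) (auto simp: infsum_add_ennreal)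
  also have "\<dots> \<le> (\<Sum>\<^sub>\<infinity>y\<in>B. \<Sum>\<^sub>\<infinity>x\<in>A. f x y)"
    using F by (intro infsum_mono_ennreal sum_le_infsum_ennreal)
  finally show "(\<Sum>x\<in>F. \<Sum>\<^sub>\<infinity>y\<in>B. f x y) \<le> (\<Sum>\<^sub>\<infinity>y\<in>B. \<Sum>\<^sub>\<infinity>x\<in>A. f x y)" .
qed

lemma infsum_swap_ennreal:
  "(\<Sum>\<^sub>\<infinity>x\<in>A. \<Sum>\<^sub>\<infinity>y\<in>B. f x y) = (\<Sum>\<^sub>\<infinity>y\<in>B. \<Sum>\<^sub>\<infinity>x\<in>A. f x y :: ennreal)"
  by (rule antisym; rule infsum_swap_le_ennreal)

text \<open>A finite set of pairs lies in the product of its two projections. This direction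
  suffices to derive absolute summability over pairs from an iterated estimate.\<close>

lemma infsum_Times_le_ennreal:
  "(\<Sum>\<^sub>\<infinity>(x, y)\<in>A \<times> B. f x y) \<le> (\<Sum>\<^sub>\<infinity>x\<in>A. \<Sum>\<^sub>\<infinity>y\<in>B. f x y :: ennreal)"
proof (rule infsum_ennreal_least)
  fix F assume F: "finite F" "F \<subseteq> A \<times> B"
  have "(\<Sum>(x, y)\<in>F. f x y) \<le> (\<Sum>(x, y)\<in>fst ` F \<times> snd ` F. f x y)"
    using F(1) by (intro sum_mono2) (auto simp: rev_image_eqI)
  also have "\<dots> = (\<Sum>x\<in>fst ` F. \<Sum>y\<in>snd ` F. f x y)"
    by (simp add: sum.cartesian_product)
  also have "\<dots> \<le> (\<Sum>x\<in>fst ` F. \<Sum>\<^sub>\<infinity>y\<in>B. f x y)"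
    using F by (intro sum_mono sum_le_infsum_ennreal) auto
  also have "\<dots> \<le> (\<Sum>\<^sub>\<infinity>x\<in>A. \<Sum>\<^sub>\<infinity>y\<in>B. f x y)"
    using F by (intro sum_le_infsum_ennreal) auto
  finally show "(\<Sum>(x, y)\<in>F. f x y) \<le> (\<Sum>\<^sub>\<infinity>x\<in>A. \<Sum>\<^sub>\<infinity>y\<in>B. f x y)" .
qed

section \<open>Power inequalities\<close>

text \<open>The convex p-th power lies above its tangent at t; solving the tangent inequality for x
  gives this bound, with equality at x = t. The free t makes the right side linear in the p-th power
  of x, so that the bound can be summed before t is optimised.\<close>

lemma ennpowr_Young:
  assumes "1 < p" "0 < t"
  shows "x \<le> ennreal (t powr (1 - p) / p) * ennpowr x p + ennreal ((1 - 1 / p) * t)"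
proof (cases x)
  case (real x)
  have "x / t * 1 \<le> (x / t) powr p / p + 1 powr (p / (p - 1)) / (p / (p - 1))"
    using assms real by (intro Youngs_inequality) (auto simp: field_simps)
  also have "\<dots> = (x / t) powr p / p + (1 - 1 / p)"
    using assms by (simp add: field_simps)
  finally have "x \<le> t * ((x / t) powr p / p + (1 - 1 / p))"
    using assms by (simp add: field_simps)
  also have "t * ((x / t) powr p / p + (1 - 1 / p))
      = t powr (1 - p) / p * x powr p + (1 - 1 / p) * t"
    using assms real by (simp add: powr_divide powr_diff field_simps)
  finally have "ennreal x \<le> ennreal (t powr (1 - p) / p * x powr p + (1 - 1 / p) * t)"
    by (rule ennreal_leI)
  also have "\<dots> = ennreal (t powr (1 - p) / p) * ennreal (x powr p) + ennreal ((1 - 1 / p) * t)"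
    using assms by (subst ennreal_plus) (auto simp flip: ennreal_mult)
  finally show ?thesis
    using real by (simp add: ennpowr_ennreal)
next
  case top
  then show ?thesis using assms by (simp add: ennreal_mult_top)
qed

text \<open>Jensen's inequality for the p-th power under a weight of finite total mass, equivalently
  Hoelder's inequality. Summing Young's inequality with one common t and then choosing the best t
  proves it.\<close>

lemma ennpowr_infsum_weighted:
  fixes f w :: "'a \<Rightarrow> ennreal"
  assumes p: "1 < p" and W: "infsum w A < top"
  shows "ennpowr (\<Sum>\<^sub>\<infinity>x\<in>A. f x * w x) p
    \<le> ennpowr (infsum w A) (p - 1) * (\<Sum>\<^sub>\<infinity>x\<in>A. ennpowr (f x) p * w x)"
    (is "ennpowr ?S p \<le> _ * ?P")
proof -
  \<comment> \<open>If \<open>?S\<close> is not 0, some weight is nonzero, so an infinite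
    \<open>?P\<close> comes with nonzero total mass and makes the right side infinite.\<close>
  consider "?S = 0" | "infsum w A \<noteq> 0" "?P = top" | "?S \<noteq> 0" "?P \<noteq> top"
    by (force simp: infsum_ennreal_eq_0_iff)
  then show ?thesis
  proof cases
    case 3
    then have "infsum w A \<noteq> 0" "?P \<noteq> 0"
      by (auto simp: infsum_ennreal_eq_0_iff)
    then obtain P W where P: "?P = ennreal P" "0 < P" and W: "infsum w A = ennreal W" "0 < W"
      using 3 W by (cases ?P; cases "infsum w A") (auto simp: less_le)
    \<comment> \<open>This t minimises the summed Young bound
      \<open>t powr (1 - p) / p * P + (1 - 1 / p) * t * W\<close>. The minimum is
      \<open>t * W\<close>, whose p-th power is the claimed right side.\<close>
    define t where "t = (P / W) powr (1 / p)"
    have t: "0 < t" and tp: "t powr p = P / W"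
      using P W p by (auto simp: t_def powr_powr)
    have "?S \<le> (\<Sum>\<^sub>\<infinity>x\<in>A. (ennreal (t powr (1 - p) / p) * ennpowr (f x) p + ennreal ((1 - 1 / p) * t)) * w x)"
      by (intro infsum_mono_ennreal mult_right_mono ennpowr_Young p t) simp
    also have "\<dots> = ennreal (t powr (1 - p) / p) * ?P + ennreal ((1 - 1 / p) * t) * infsum w A"
      by (simp add: distrib_right infsum_add_ennreal infsum_cmult_ennreal mult.assoc)
    also have "\<dots> = ennreal (t powr (1 - p) / p * P + (1 - 1 / p) * t * W)"
      unfolding P(1) W(1) using P W p t
      by (subst ennreal_plus) (auto simp flip: ennreal_mult)
    also have "t powr (1 - p) / p * P + (1 - 1 / p) * t * W = t * W"
      using P W p t tp by (simp add: powr_diff field_simps)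
    finally have "ennpowr ?S p \<le> ennpowr (ennreal (t * W)) p"
      using p by (intro ennpowr_mono) auto
    also have "\<dots> = ennreal (W powr (p - 1) * P)"
      using P W p t tp by (simp add: ennpowr_ennreal powr_mult powr_diff)
    also have "\<dots> = ennpowr (infsum w A) (p - 1) * ?P"
      using P W by (simp add: ennpowr_ennreal ennreal_mult)
    finally show ?thesis .
  qed (auto simp: ennreal_mult_top)
qed

text \<open>Convexity of the p-th power at the points x/a and y/b with masses a and b. Taking for a
  and b the norms of two sequences makes the bound sum up to the p-th power of a + b, which is
  Minkowski's inequality.\<close>

lemma ennpowr_plus_le:
  assumes "1 \<le> p" "0 < a" "0 < b"
  shows "ennpowr (x + y) p \<le> ennreal ((a + b) powr (p - 1))
    * (ennreal (a powr (1 - p)) * ennpowr x p + ennreal (b powr (1 - p)) * ennpowr y p)"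
proof (cases "p = 1")
  case True
  then show ?thesis using assms by simp
next
  case False
  have scale: "z * ennreal (1 / c) * ennreal c = z"
    "ennpowr (z * ennreal (1 / c)) p * ennreal c = ennreal (c powr (1 - p)) * ennpowr z p"
    if "0 < c" for c z
  proof -
    show "z * ennreal (1 / c) * ennreal c = z"
      using that by (simp add: mult.assoc flip: ennreal_mult)
    have "ennpowr (z * ennreal (1 / c)) p * ennreal c = ennpowr z p * (ennreal ((1 / c) powr p) * ennreal c)"
      using that by (simp add: ennpowr_mult ennpowr_ennreal mult.assoc)
    also have "ennreal ((1 / c) powr p) * ennreal c = ennreal (c powr (1 - p))"
      using that by (simp add: powr_divide powr_diff flip: ennreal_mult)
    finally show "ennpowr (z * ennreal (1 / c)) p * ennreal c = ennreal (c powr (1 - p)) * ennpowr z p"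
      by (simp add: mult.commute)
  qed
  \<comment> \<open>The type \<open>bool\<close> serves as the two-point index set carrying the
    masses a and b.\<close>
  let ?f = "\<lambda>i. if i then x * ennreal (1 / a) else y * ennreal (1 / b)"
  let ?w = "\<lambda>i. if i then ennreal a else ennreal b"
  have "ennpowr (\<Sum>\<^sub>\<infinity>i\<in>UNIV. ?f i * ?w i) p
    \<le> ennpowr (infsum ?w UNIV) (p - 1) * (\<Sum>\<^sub>\<infinity>i\<in>UNIV. ennpowr (?f i) p * ?w i)"
    using assms False by (intro ennpowr_infsum_weighted) (auto simp: UNIV_bool)
  then show ?thesis
    using assms by (simp add: UNIV_bool scale ennpowr_ennreal add.commute flip: ennreal_plus)
qed

text \<open>Each term is at most the whole sum S, so one factor of its s-th power is kept and the
  remaining s - 1 are bounded by S.\<close>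

lemma suminf_ennpowr_le:
  assumes "1 \<le> s"
  shows "(\<Sum>n. ennpowr (f n) s) \<le> ennpowr (\<Sum>n. f n) s"
proof (cases "s = 1")
  case False
  have "f i \<le> (\<Sum>n. f n)" for i
    using le_infsum_ennreal[of i UNIV f] by (simp add: infsum_eq_suminf_ennreal)
  then have "ennpowr (f n) s \<le> ennpowr (\<Sum>n. f n) (s - 1) * f n" for n
    using ennpowr_add[of "f n" "s - 1" 1] assms False by (auto intro!: mult_right_mono ennpowr_mono)
  then have "(\<Sum>n. ennpowr (f n) s) \<le> (\<Sum>n. ennpowr (\<Sum>n. f n) (s - 1) * f n)"
    by (intro suminf_le) auto
  also have "\<dots> = ennpowr (\<Sum>n. f n) s"
    using ennpowr_add[of "\<Sum>n. f n" "s - 1" 1] by simp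
  finally show ?thesis .
qed simp

section \<open>Weighted norms of sequences\<close>

definition wt :: "real \<Rightarrow> nat \<Rightarrow> ennreal" where
  "wt a n = ennreal ((real n + 1) powr a)"

lemma wt_add: "wt (a + b) n = wt a n * wt b n"
  by (simp add: wt_def powr_add ennreal_mult)

lemma ennpowr_wt: "ennpowr (wt a n) p = wt (a * p) n"
  by (simp add: wt_def ennpowr_ennreal powr_powr)

lemma wt_mono: "a \<le> b \<Longrightarrow> wt a n \<le> wt b n"
  by (simp add: wt_def ennreal_leI powr_mono)

lemma wt_0 [simp]: "wt 0 n = 1"
  by (simp add: wt_def)

lemma wt_at_0 [simp]: "wt a 0 = 1"
  by (simp add: wt_def)

lemma one_le_wt: "0 \<le> a \<Longrightarrow> 1 \<le> wt a n"
  using wt_mono[of 0 a n] by simp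

text \<open>The Beurling norm as a functional of an arbitrary sequence: it is also applied to sums,
  index-halved sequences and limits of lower bounds, which need not be off-diagonal suprema of a
  matrix.\<close>

definition seq_norm :: "real \<Rightarrow> ennreal \<Rightarrow> real \<Rightarrow> (nat \<Rightarrow> ennreal) \<Rightarrow> ennreal" where
  "seq_norm d r \<alpha> h =
     (if r = \<infinity> then (SUP n. h n * ennreal ((real n + 1) powr \<alpha>))
      else ennpowr (\<Sum>n. ennpowr (h n) (enn2real r)
                        * ennreal ((real n + 1) powr (\<alpha> * enn2real r + d - 1)))
                   (recip r))"

lemma beurling_norm_eq_seq_norm:
  "beurling_norm V E d r \<alpha> A = seq_norm d r \<alpha> (off_diag_sup V E A)"
  by (simp add: beurling_norm_def seq_norm_def)

lemma recip_ennreal: "1 \<le> p \<Longrightarrow> recip (ennreal p) = 1 / p"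
  using divide_ennreal[of 1 p] by (simp add: recip_def)

lemma recip_top [simp]: "recip top = 0"
  by (simp add: recip_def)

lemma exponent_cases [consumes 1, case_names top finite]:
  assumes "1 \<le> r"
  obtains "r = top" | p where "r = ennreal p" "1 \<le> p" "recip r = 1 / p"
  using assms recip_ennreal by (cases r) auto

lemma seq_norm_top: "seq_norm d top \<alpha> h = (SUP n. h n * wt \<alpha> n)"
  by (simp add: seq_norm_def wt_def)

text \<open>Splitting the weight exhibits an \<open>\<ell>\<^sup>p\<close> norm of
  \<open>h n * wt \<alpha> n\<close> with respect to the measure of mass \<open>wt (d - 1) n\<close>
  at n. The factor \<alpha> then enters as it does in the supremum norm, and d belongs to the
  measure alone.\<close>

lemma seq_norm_ennreal:
  assumes "1 \<le> p"
  shows "seq_norm d (ennreal p) \<alpha> h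
    = ennpowr (\<Sum>n. ennpowr (h n * wt \<alpha> n) p * wt (d - 1) n) (1 / p)"
proof -
  have "ennpowr (h n) p * ennreal ((real n + 1) powr (\<alpha> * p + d - 1))
      = ennpowr (h n * wt \<alpha> n) p * wt (d - 1) n" for n
    using wt_add[of "\<alpha> * p" "d - 1" n]
    by (simp add: ennpowr_mult ennpowr_wt mult.assoc add_diff_eq) (simp add: wt_def)
  then show ?thesis
    using assms by (simp add: seq_norm_def recip_ennreal)
qed

lemma seq_norm_ennreal_le_iff:
  assumes "1 \<le> p"
  shows "seq_norm d (ennreal p) \<alpha> h \<le> c
    \<longleftrightarrow> (\<Sum>n. ennpowr (h n * wt \<alpha> n) p * wt (d - 1) n) \<le> ennpowr c p"
  using assms by (simp add: seq_norm_ennreal ennpowr_le_iff_left)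

lemma ennpowr_seq_norm:
  assumes "1 \<le> p"
  shows "ennpowr (seq_norm d (ennreal p) \<alpha> h) p = (\<Sum>n. ennpowr (h n * wt \<alpha> n) p * wt (d - 1) n)"
  using assms by (simp add: seq_norm_ennreal ennpowr_powr)

lemma seq_norm_1_0: "seq_norm d 1 0 h = (\<Sum>n. h n * wt (d - 1) n)"
  using seq_norm_ennreal[of 1 d 0 h] by simp

section \<open>Order, homogeneity, monotone limits and the triangle inequality for weighted
  norms\<close>

lemma seq_norm_mono:
  assumes "1 \<le> r" "\<alpha> \<le> \<beta>" "\<And>n. g n \<le> h n"
  shows "seq_norm d r \<alpha> g \<le> seq_norm d r \<beta> h"
proof -
  have *: "g n * wt \<alpha> n \<le> h n * wt \<beta> n" for n
    using assms by (intro mult_mono wt_mono) auto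
  from assms(1) show ?thesis
  proof (cases r rule: exponent_cases)
    case top
    then show ?thesis using * by (auto simp: seq_norm_top intro: SUP_mono)
  next
    case (finite p)
    then show ?thesis
      using * by (auto simp: seq_norm_ennreal intro!: ennpowr_mono suminf_le mult_right_mono)
  qed
qed

lemma seq_norm_cmult:
  assumes "1 \<le> r"
  shows "seq_norm d r \<alpha> (\<lambda>n. c * h n) = c * seq_norm d r \<alpha> h"
  using assms
proof (cases r rule: exponent_cases)
  case top
  then show ?thesis by (simp add: seq_norm_top SUP_mult_left_ennreal mult.assoc)
next
  case (finite p)
  then show ?thesis
    by (simp add: seq_norm_ennreal ennpowr_mult ennpowr_powr mult.assoc)
qed

text \<open>All weights equal 1 at index 0. Since \<open>h 0\<close> is the supremum of all entries
  when h comes from a matrix, this is what bounds each entry by the norm.\<close>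

lemma seq_norm_at_0_le:
  assumes "1 \<le> r"
  shows "h 0 \<le> seq_norm d r \<alpha> h"
  using assms
proof (cases r rule: exponent_cases)
  case top
  then show ?thesis by (auto simp: seq_norm_top intro: SUP_upper2[of 0])
next
  case (finite p)
  then have "ennpowr (h 0) p \<le> (\<Sum>n. ennpowr (h n * wt \<alpha> n) p * wt (d - 1) n)"
    using le_infsum_ennreal[of 0 UNIV "\<lambda>n. ennpowr (h n * wt \<alpha> n) p * wt (d - 1) n"]
    by (simp add: infsum_eq_suminf_ennreal)
  with finite show ?thesis
    by (simp add: seq_norm_ennreal flip: ennpowr_le_iff_right)
qed

text \<open>Monotone convergence: powers and sums commute with suprema of increasing sequences. It
  is the second half of the Fatou argument for completeness.\<close>

lemma seq_norm_SUP_le: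
  assumes "1 \<le> r" "\<And>n. incseq (\<lambda>m. g m n)" "\<And>m. seq_norm d r \<alpha> (g m) \<le> c"
  shows "seq_norm d r \<alpha> (\<lambda>n. SUP m. g m n) \<le> c"
  using assms(1)
proof (cases r rule: exponent_cases)
  case top
  with assms(3) show ?thesis
    by (auto simp: seq_norm_top SUP_mult_right_ennreal SUP_le_iff)
next
  case (finite p)
  have "(\<Sum>n. ennpowr ((SUP m. g m n) * wt \<alpha> n) p * wt (d - 1) n)
      = (\<Sum>n. SUP m. ennpowr (g m n * wt \<alpha> n) p * wt (d - 1) n)"
    using finite by (simp add: SUP_mult_right_ennreal ennpowr_SUP)
  also have "\<dots> = (SUP m. \<Sum>n. ennpowr (g m n * wt \<alpha> n) p * wt (d - 1) n)"
    using assms(2) finite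
    by (intro ennreal_suminf_SUP_eq) (auto simp: incseq_def intro!: mult_right_mono ennpowr_mono)
  also have "\<dots> \<le> ennpowr c p"
    using assms(3) finite by (auto simp: seq_norm_ennreal_le_iff SUP_le_iff)
  finally show ?thesis
    using finite by (simp add: seq_norm_ennreal_le_iff)
qed

text \<open>Minkowski's inequality, from the two-point convexity bound with a and b close to the two
  norms. An approximation is used because a and b have to be positive while the norms may
  vanish.\<close>

lemma seq_norm_add_le:
  assumes "1 \<le> r"
  shows "seq_norm d r \<alpha> (\<lambda>n. g n + h n) \<le> seq_norm d r \<alpha> g + seq_norm d r \<alpha> h"
  using assms
proof (cases r rule: exponent_cases)
  case top
  have "(g n + h n) * wt \<alpha> n \<le> (SUP n. g n * wt \<alpha> n) + (SUP n. h n * wt \<alpha> n)" for n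
    unfolding distrib_right by (intro add_mono SUP_upper) auto
  then show ?thesis unfolding top seq_norm_top by (intro SUP_least)
next
  case (finite p)
  show ?thesis
  proof (rule ennreal_le_epsilon)
    fix e :: real assume e: "0 < e" and fin: "seq_norm d r \<alpha> g + seq_norm d r \<alpha> h < top"
    \<comment> \<open>Half of e goes to each norm: a and b become positive, dominate the norms, and
      add up to the sum of the norms plus e.\<close>
    define a b where "a = enn2real (seq_norm d r \<alpha> g) + e / 2"
      and "b = enn2real (seq_norm d r \<alpha> h) + e / 2"
    have ab: "0 < a" "0 < b"
      unfolding a_def b_def using e by (auto intro!: add_nonneg_pos)
    have le: "seq_norm d r \<alpha> g \<le> ennreal a" "seq_norm d r \<alpha> h \<le> ennreal b"
    proof -
      have *: "x \<le> ennreal (enn2real x + e / 2)" if "x < top" for x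
        using that e by (cases x) (auto intro: ennreal_leI)
      show "seq_norm d r \<alpha> g \<le> ennreal a" "seq_norm d r \<alpha> h \<le> ennreal b"
        unfolding a_def b_def using fin by (auto intro!: *)
    qed
    let ?G = "\<lambda>n. ennpowr (g n * wt \<alpha> n) p * wt (d - 1) n"
    let ?H = "\<lambda>n. ennpowr (h n * wt \<alpha> n) p * wt (d - 1) n"
    have "ennpowr ((g n + h n) * wt \<alpha> n) p * wt (d - 1) n \<le> ennreal ((a + b) powr (p - 1))
        * (ennreal (a powr (1 - p)) * ?G n + ennreal (b powr (1 - p)) * ?H n)" for n
      using mult_right_mono[OF ennpowr_plus_le[OF finite(2) ab, of "g n * wt \<alpha> n" "h n * wt \<alpha> n"], of "wt (d - 1) n"]
      by (simp add: distrib_right mult.assoc)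
    then have "(\<Sum>n. ennpowr ((g n + h n) * wt \<alpha> n) p * wt (d - 1) n)
      \<le> (\<Sum>n. ennreal ((a + b) powr (p - 1))
        * (ennreal (a powr (1 - p)) * ?G n + ennreal (b powr (1 - p)) * ?H n))"
      by (intro suminf_le) auto
    also have "\<dots> = ennreal ((a + b) powr (p - 1))
        * (ennreal (a powr (1 - p)) * suminf ?G + ennreal (b powr (1 - p)) * suminf ?H)"
      by (simp flip: suminf_add)
    also have "\<dots> \<le> ennreal ((a + b) powr (p - 1))
        * (ennreal (a powr (1 - p)) * ennreal (a powr p) + ennreal (b powr (1 - p)) * ennreal (b powr p))"
      using le finite ab
      by (intro mult_left_mono add_mono) (auto simp: seq_norm_ennreal_le_iff ennpowr_ennreal)
    also have "\<dots> = ennreal ((a + b) powr (p - 1) * (a + b))"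
    proof -
      have "a powr (1 - p) * a powr p = a" "b powr (1 - p) * b powr p = b"
        using ab by (simp_all flip: powr_add)
      then show ?thesis
        using ab by (simp flip: ennreal_mult ennreal_plus)
    qed
    also have "\<dots> = ennpowr (ennreal (a + b)) p"
      using ab by (simp add: ennpowr_ennreal powr_diff del: ennreal_plus)
    finally have "seq_norm d r \<alpha> (\<lambda>n. g n + h n) \<le> ennreal (a + b)"
      using finite by (simp add: seq_norm_ennreal_le_iff)
    also have "a + b = enn2real (seq_norm d r \<alpha> g) + enn2real (seq_norm d r \<alpha> h) + e"
      by (simp add: a_def b_def)
    also have "ennreal \<dots> = seq_norm d r \<alpha> g + seq_norm d r \<alpha> h + ennreal e"
      using e fin by (subst ennreal_plus; simp add: add_nonneg_nonneg)+
    finally show "seq_norm d r \<alpha> (\<lambda>n. g n + h n) \<le> seq_norm d r \<alpha> g + seq_norm d r \<alpha> h + ennreal e" .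
  qed
qed

text \<open>By \<open>1 \<le> d\<close> every point of the measure has mass at least 1. A weighted
  sum then dominates each unweighted term, and raising the mass to a power t \<ge> 1 does not
  decrease it, which reduces the finite case to the inequality between a sum of t-th powers and the
  t-th power of the sum.\<close>

lemma seq_norm_antimono_exponent:
  assumes "1 \<le> r" "r \<le> s" "1 \<le> d"
  shows "seq_norm d s \<alpha> h \<le> seq_norm d r \<alpha> h"
proof -
  have "1 \<le> s" using assms by auto
  from assms(1) show ?thesis
  proof (cases r rule: exponent_cases)
    case top
    with assms show ?thesis by (simp add: top_unique)
  next
    case p: (finite p)
    let ?f = "\<lambda>n. ennpowr (h n * wt \<alpha> n) p * wt (d - 1) n"
    from \<open>1 \<le> s\<close> show ?thesis
    proof (cases s rule: exponent_cases)
      case top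
      have "h n * wt \<alpha> n \<le> ennpowr (suminf ?f) (1 / p)" for n
      proof -
        have "ennpowr (h n * wt \<alpha> n) p * 1 \<le> ?f n"
          using assms by (intro mult_left_mono one_le_wt) auto
        also have "\<dots> \<le> suminf ?f"
          using le_infsum_ennreal[of n UNIV ?f] by (simp add: infsum_eq_suminf_ennreal)
        finally show ?thesis using p by (simp flip: ennpowr_le_iff_right)
      qed
      with top p show ?thesis by (auto simp: seq_norm_top seq_norm_ennreal intro: SUP_least)
    next
      case q: (finite q)
      have pq: "p \<le> q" using assms p q by (simp add: ennreal_le_iff)
      define t where "t = q / p"
      have t: "1 \<le> t" and q_eq: "q = p * t" using p pq by (auto simp: t_def)
      have "ennpowr (h n * wt \<alpha> n) q * wt (d - 1) n \<le> ennpowr (?f n) t" for n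
      proof -
        have "wt (d - 1) n \<le> wt ((d - 1) * t) n"
          using assms t mult_left_mono[of 1 t "d - 1"] by (intro wt_mono) auto
        then show ?thesis
          by (simp add: ennpowr_mult[of _ "wt (d - 1) n"] ennpowr_wt[of "d - 1"] ennpowr_powr q_eq mult_left_mono)
      qed
      then have "(\<Sum>n. ennpowr (h n * wt \<alpha> n) q * wt (d - 1) n) \<le> (\<Sum>n. ennpowr (?f n) t)"
        by (intro suminf_le) auto
      also have "\<dots> \<le> ennpowr (suminf ?f) t"
        by (rule suminf_ennpowr_le[OF t])
      also have "\<dots> = ennpowr (seq_norm d r \<alpha> h) q"
        using p by (simp add: seq_norm_ennreal ennpowr_powr q_eq)
      finally show ?thesis using q by (simp add: seq_norm_ennreal_le_iff)
    qed
  qed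
qed

text \<open>Mean value theorem, with the derivative increasing because \<open>1 \<le> d\<close>. The
  index 0 is separated since the power is differentiated at positive points only.\<close>

lemma powr_diff_le_of_exponent_ge_1:
  assumes "1 \<le> d"
  shows "(real n + 1) powr d - real n powr d \<le> d * (real n + 1) powr (d - 1)"
proof (cases "n = 0")
  case False
  then have "((\<lambda>x. x powr d) has_real_derivative d * x powr (d - 1)) (at x)" if "real n \<le> x" for x
    using that by (intro has_real_derivative_powr) auto
  then obtain z where z: "real n < z" "z < real n + 1"
    "(real n + 1) powr d - real n powr d = (real n + 1 - real n) * (d * z powr (d - 1))"
    using MVT2[of "real n" "real n + 1" "\<lambda>x. x powr d" "\<lambda>x. d * x powr (d - 1)"] by auto
  then show ?thesis
    using assms by (auto intro!: mult_left_mono powr_mono2)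
qed (use assms in auto)

text \<open>The integral comparison behind the convergence of the sum of \<open>k powr - s\<close>:
  on the interval from n + 1 to n + 2 the decreasing integrand is at least its value at the right
  end. The mean value theorem replaces the integral.\<close>

lemma powr_diff_ge_of_exponent_neg:
  assumes "1 < s"
  shows "(s - 1) * (real n + 2) powr - s \<le> (real n + 1) powr (1 - s) - (real n + 2) powr (1 - s)"
proof -
  have "((\<lambda>x. x powr (1 - s)) has_real_derivative (1 - s) * x powr (1 - s - 1)) (at x)"
    if "real n + 1 \<le> x" for x
    using that by (intro has_real_derivative_powr) auto
  then obtain z where z: "real n + 1 < z" "z < real n + 2"
    "(real n + 2) powr (1 - s) - (real n + 1) powr (1 - s) = (real n + 2 - (real n + 1)) * ((1 - s) * z powr (1 - s - 1))"
    using MVT2[of "real n + 1" "real n + 2" "\<lambda>x. x powr (1 - s)" "\<lambda>x. (1 - s) * x powr (1 - s - 1)"] by auto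
  moreover have "(s - 1) * (real n + 2) powr - s \<le> (s - 1) * z powr - s"
    using assms z(1,2) by (intro mult_left_mono powr_mono2') auto
  ultimately show ?thesis by (simp add: algebra_simps)
qed

lemma suminf_wt_le:
  assumes "1 < s"
  shows "(\<Sum>n. wt (- s) n) \<le> ennreal (s / (s - 1))"
proof (rule suminf_le_const)
  fix N
  \<comment> \<open>The tail of the integral is kept in the claim so that the induction telescopes.
    The first term 1 equals s/(s - 1) - 1/(s - 1).\<close>
  have "(\<Sum>n<Suc N. (real n + 1) powr - s) \<le> s / (s - 1) - (real N + 1) powr (1 - s) / (s - 1)" for N
  proof (induction N)
    case 0
    then show ?case using assms by (simp flip: diff_divide_distrib)
  next
    case (Suc N)
    have "(real N + 2) powr - s \<le> (real N + 1) powr (1 - s) / (s - 1) - (real N + 2) powr (1 - s) / (s - 1)"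
      using powr_diff_ge_of_exponent_neg[OF assms, of N] assms
      by (simp add: pos_le_divide_eq mult.commute flip: diff_divide_distrib)
    with Suc show ?case by (simp add: add.commute)
  qed
  moreover have "0 \<le> (real N + 1) powr (1 - s) / (s - 1)"
    using assms by simp
  ultimately have "(\<Sum>n<Suc N. (real n + 1) powr - s) \<le> s / (s - 1)"
    by (smt (verit))
  then have "(\<Sum>n<Suc N. wt (- s) n) \<le> ennreal (s / (s - 1))"
    unfolding wt_def by (subst sum_ennreal) (auto intro: ennreal_leI)
  moreover have "(\<Sum>n<N. wt (- s) n) \<le> (\<Sum>n<Suc N. wt (- s) n)" by simp
  ultimately show "(\<Sum>n<N. wt (- s) n) \<le> ennreal (s / (s - 1))" by order
qed simp

text \<open>Hoelder's inequality: the r-sum is written as an integral against the finite measure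
  \<open>wt (- e)\<close>, to which Jensen's inequality with exponent t = q/p applies. For s =
  \<infinity> the pointwise bound by the supremum leaves the same sum of
  \<open>wt (- e)\<close>.\<close>

lemma seq_norm_embedding:
  assumes r: "1 \<le> r" "r \<le> s" and \<beta>: "\<gamma> + d * (recip r - recip s) < \<beta>"
  shows "seq_norm d r \<gamma> h \<le>
    ennreal (((\<beta> - \<gamma> - (d - 1) * (recip r - recip s)) /
       (\<beta> - \<gamma> - d * (recip r - recip s))) powr (recip r - recip s)) * seq_norm d s \<beta> h"
proof (cases "r = s")
  case True
  then show ?thesis using r \<beta> seq_norm_mono[of r \<gamma> \<beta> h h d] by simp
next
  case False
  define \<delta> where "\<delta> = recip r - recip s"
  \<comment> \<open>This is the only exponent for which both the p-sum with weight \<gamma> and the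
    q-sum with weight \<beta> take the form of integrals against \<open>wt (- e)\<close>. The
    hypothesis on \<beta> says precisely that e > 1.\<close>
  define e where "e = (\<beta> - \<gamma>) / \<delta> - d + 1"
  have "r \<noteq> top" using False r by (auto simp: top_unique)
  with r obtain p where p: "r = ennreal p" "1 \<le> p" "recip r = 1 / p"
    by (cases r rule: exponent_cases) auto
  have s1: "1 \<le> s" using r by auto
  have \<delta>: "0 < \<delta>"
    using s1
  proof (cases s rule: exponent_cases)
    case (finite q)
    then have "p < q" using p r False by (simp add: ennreal_le_iff less_le)
    then show ?thesis using p finite by (simp add: \<delta>_def frac_less2)
  qed (use p in \<open>auto simp: \<delta>_def\<close>)
  have e: "1 < e" using \<beta> \<delta> by (simp add: e_def field_simps flip: \<delta>_def)
  have const: "(\<beta> - \<gamma> - (d - 1) * \<delta>) / (\<beta> - \<gamma> - d * \<delta>) = e / (e - 1)"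
  proof -
    have "e = (\<beta> - \<gamma> - (d - 1) * \<delta>) / \<delta>" "e - 1 = (\<beta> - \<gamma> - d * \<delta>) / \<delta>"
      using \<delta> by (auto simp: e_def field_simps)
    then show ?thesis using \<delta> by simp
  qed
  have "seq_norm d r \<gamma> h \<le> ennpowr (\<Sum>n. wt (- e) n) \<delta> * seq_norm d s \<beta> h"
    using s1
  proof (cases s rule: exponent_cases)
    case top
    let ?N = "seq_norm d s \<beta> h"
    have \<delta>p: "\<delta> * p = 1" using p top by (simp add: \<delta>_def)
    have "h n * wt \<gamma> n \<le> ?N * wt (\<gamma> - \<beta>) n" for n
    proof -
      have "h n * wt \<beta> n \<le> ?N" by (auto simp: top seq_norm_top intro: SUP_upper)
      then have "h n * wt \<beta> n * wt (\<gamma> - \<beta>) n \<le> ?N * wt (\<gamma> - \<beta>) n" by (rule mult_right_mono) simp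
      then show ?thesis by (simp add: mult.assoc flip: wt_add)
    qed
    then have "ennpowr (h n * wt \<gamma> n) p * wt (d - 1) n
        \<le> ennpowr (?N * wt (\<gamma> - \<beta>) n) p * wt (d - 1) n" for n
      using p by (intro mult_right_mono ennpowr_mono) auto
    also have "ennpowr (?N * wt (\<gamma> - \<beta>) n) p * wt (d - 1) n = ennpowr ?N p * wt (- e) n" for n
    proof -
      have "(\<gamma> - \<beta>) * p + (d - 1) = - e"
        using \<delta>p \<delta> p top by (simp add: e_def \<delta>_def field_simps)
      then show ?thesis
        by (simp add: ennpowr_mult ennpowr_wt mult.assoc flip: wt_add)
    qed
    finally have "(\<Sum>n. ennpowr (h n * wt \<gamma> n) p * wt (d - 1) n) \<le> (\<Sum>n. ennpowr ?N p * wt (- e) n)"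
      by (intro suminf_le) auto
    also have "\<dots> = ennpowr (ennpowr (\<Sum>n. wt (- e) n) \<delta> * ?N) p"
      by (simp add: ennpowr_mult ennpowr_powr \<delta>p mult.commute)
    finally show ?thesis using p by (simp add: seq_norm_ennreal_le_iff)
  next
    case q: (finite q)
    have pq: "p < q" using p q r False by (simp add: ennreal_le_iff less_le)
    define t where "t = q / p"
    have t: "1 < t" and q_eq: "q = p * t" using p pq by (auto simp: t_def)
    \<comment> \<open>Jensen's inequality puts the exponent t - 1 on the total mass; after the q-th
      root it is \<delta>.\<close>
    have t\<delta>: "t - 1 = q * \<delta>"
      using p q pq by (simp add: \<delta>_def t_def field_simps)
    \<comment> \<open>The exponent of the weight is forced by the two requirements
      \<open>lhs\<close> and \<open>rhs\<close>: \<open>g\<close> integrates to the p-sum, its t-th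
      power to the q-sum.\<close>
    define g where "g n = ennpowr (h n) p * wt (\<gamma> * p + (\<beta> - \<gamma>) / \<delta>) n" for n
    have lhs: "ennpowr (h n * wt \<gamma> n) p * wt (d - 1) n = g n * wt (- e) n" for n
    proof -
      have "wt (\<gamma> * p) n * wt (d - 1) n = wt (\<gamma> * p + (\<beta> - \<gamma>) / \<delta>) n * wt (- e) n"
        unfolding wt_add[symmetric] by (simp add: e_def)
      then show ?thesis
        by (simp add: g_def ennpowr_mult ennpowr_wt mult.assoc)
    qed
    have rhs: "ennpowr (g n) t * wt (- e) n = ennpowr (h n * wt \<beta> n) q * wt (d - 1) n" for n
    proof -
      have "(\<gamma> * p + (\<beta> - \<gamma>) / \<delta>) * t + - e = \<gamma> * q + (\<beta> - \<gamma>) / \<delta> * (t - 1) + (d - 1)"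
        unfolding e_def q_eq ring_distribs by (simp add: algebra_simps)
      also have "\<dots> = \<beta> * q + (d - 1)"
      proof -
        have "(\<beta> - \<gamma>) / \<delta> * (t - 1) = (\<beta> - \<gamma>) * q" using \<delta> by (simp add: t\<delta>)
        then show ?thesis by (simp add: algebra_simps)
      qed
      finally have "wt ((\<gamma> * p + (\<beta> - \<gamma>) / \<delta>) * t) n * wt (- e) n = wt (\<beta> * q) n * wt (d - 1) n"
        unfolding wt_add[symmetric] by (rule arg_cong)
      then show ?thesis
        by (simp only: g_def ennpowr_mult ennpowr_wt ennpowr_powr mult.assoc flip: q_eq)
    qed
    have fin: "(\<Sum>n. wt (- e) n) < top"
      using suminf_wt_le[OF e] by (auto simp: less_top[symmetric] top_unique)
    have "ennpowr (seq_norm d r \<gamma> h) q = ennpowr (\<Sum>n. g n * wt (- e) n) t"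
      unfolding q_eq p(1) ennpowr_powr[symmetric] ennpowr_seq_norm[OF p(2)] lhs ..
    also have "\<dots> \<le> ennpowr (\<Sum>n. wt (- e) n) (t - 1) * (\<Sum>n. ennpowr (g n) t * wt (- e) n)"
      using ennpowr_infsum_weighted[OF t, of "wt (- e)" UNIV g] fin by (simp add: infsum_eq_suminf_ennreal)
    also have "\<dots> = ennpowr (ennpowr (\<Sum>n. wt (- e) n) \<delta> * seq_norm d s \<beta> h) q"
      unfolding q(1) rhs ennpowr_mult[of "ennpowr _ _"] ennpowr_powr ennpowr_seq_norm[OF q(2)] t\<delta>
      by (simp add: mult.commute)
    finally show ?thesis
      using q(2) by (simp add: ennpowr_le_cancel)
  qed
  also have "ennpowr (\<Sum>n. wt (- e) n) \<delta> \<le> ennpowr (ennreal (e / (e - 1))) \<delta>"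
    by (intro ennpowr_mono \<delta> suminf_wt_le e)
  also have "\<dots> = ennreal ((e / (e - 1)) powr \<delta>)"
    using e by (simp add: ennpowr_ennreal)
  finally show ?thesis
    by (simp add: const mult_right_mono flip: \<delta>_def)
qed

section \<open>Halving the index\<close>

lemma suminf_even_odd_le:
  fixes f :: "nat \<Rightarrow> ennreal"
  shows "suminf f \<le> (\<Sum>m. f (2 * m)) + (\<Sum>m. f (2 * m + 1))"
proof (rule suminf_le_const)
  fix N
  have "(\<Sum>n<N. f n) \<le> (\<Sum>n<2 * N. f n)"
    by (intro sum_mono2) auto
  also have "\<dots> = (\<Sum>m<N. f (2 * m)) + (\<Sum>m<N. f (2 * m + 1))"
    by (induction N) (auto simp: algebra_simps)
  also have "\<dots> \<le> (\<Sum>m. f (2 * m)) + (\<Sum>m. f (2 * m + 1))"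
    by (intro add_mono sum_le_suminf) auto
  finally show "(\<Sum>n<N. f n) \<le> (\<Sum>m. f (2 * m)) + (\<Sum>m. f (2 * m + 1))" .
qed simp

lemma wt_double_le:
  assumes "0 \<le> a" "n \<le> 2 * m"
  shows "wt a n \<le> ennreal (2 powr a) * wt a m"
proof -
  have "(real n + 1) powr a \<le> (2 * (real m + 1)) powr a"
    using assms by (intro powr_mono2) auto
  also have "\<dots> = 2 powr a * (real m + 1) powr a"
    by (rule powr_mult)
  finally show ?thesis
    by (simp add: wt_def ennreal_leI flip: ennreal_mult)
qed

text \<open>The index \<open>Suc n div 2\<close> is n/2 rounded up. Raised to the power p, the
  weights cost \<open>2 powr (\<alpha> * p + (d - 1))\<close>, and a further factor 2 arises because
  each m > 0 is hit by exactly n = 2 m - 1 and n = 2 m.\<close>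

lemma seq_norm_half_le:
  assumes r: "1 \<le> r" and "0 \<le> \<alpha>" "1 \<le> d"
  shows "seq_norm d r \<alpha> (\<lambda>n. h (Suc n div 2)) \<le> ennreal (2 powr (\<alpha> + d * recip r)) * seq_norm d r \<alpha> h"
  using r
proof (cases r rule: exponent_cases)
  case top
  have "h (Suc n div 2) * wt \<alpha> n \<le> ennreal (2 powr \<alpha>) * (SUP n. h n * wt \<alpha> n)" for n
  proof -
    have "h (Suc n div 2) * wt \<alpha> n \<le> h (Suc n div 2) * (ennreal (2 powr \<alpha>) * wt \<alpha> (Suc n div 2))"
      using assms by (intro mult_left_mono wt_double_le) auto
    also have "\<dots> = ennreal (2 powr \<alpha>) * (h (Suc n div 2) * wt \<alpha> (Suc n div 2))"
      by (simp add: ac_simps)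
    also have "\<dots> \<le> ennreal (2 powr \<alpha>) * (SUP n. h n * wt \<alpha> n)"
      by (intro mult_left_mono SUP_upper) auto
    finally show ?thesis .
  qed
  with top show ?thesis by (auto simp: seq_norm_top intro: SUP_least)
next
  case (finite p)
  define K where "K = ennreal (2 powr (\<alpha> * p + (d - 1)))"
  let ?F = "\<lambda>n. ennpowr (h n * wt \<alpha> n) p * wt (d - 1) n"
  let ?f = "\<lambda>n. ennpowr (h (Suc n div 2) * wt \<alpha> n) p * wt (d - 1) n"
  have le: "?f n \<le> K * ?F (Suc n div 2)" for n
  proof -
    let ?m = "Suc n div 2"
    have "?f n = ennpowr (h ?m) p * wt (\<alpha> * p + (d - 1)) n"
      by (simp add: ennpowr_mult ennpowr_wt mult.assoc wt_add)
    also have "\<dots> \<le> ennpowr (h ?m) p * (K * wt (\<alpha> * p + (d - 1)) ?m)"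
      unfolding K_def using assms finite by (intro mult_left_mono wt_double_le) auto
    also have "\<dots> = K * ?F ?m"
      by (simp add: ennpowr_mult ennpowr_wt wt_add ac_simps)
    finally show ?thesis .
  qed
  have "suminf ?f \<le> (\<Sum>m. ?f (2 * m)) + (\<Sum>m. ?f (2 * m + 1))"
    by (rule suminf_even_odd_le)
  also have "\<dots> \<le> (\<Sum>m. K * ?F m) + (\<Sum>m. K * ?F (Suc m))"
    \<comment> \<open>Even n = 2 m rounds to m and odd n = 2 m + 1 to m + 1, so the odd part is a
      shifted copy of the same series.\<close>
    using le[of "2 * _"] le[of "2 * _ + 1"] by (intro add_mono suminf_le) auto
  also have "\<dots> \<le> (\<Sum>m. K * ?F m) + (\<Sum>m. K * ?F m)"
  proof -
    have "(\<Sum>m. K * ?F m) = (\<Sum>m. K * ?F (m + 1)) + (\<Sum>m<1. K * ?F m)"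
      by (rule suminf_offset) simp
    then show ?thesis by (intro add_left_mono) simp
  qed
  also have "\<dots> = 2 * K * suminf ?F"
    by (simp add: mult_2 distrib_right)
  also have "2 * K = ennreal (2 powr ((\<alpha> + d * recip r) * p))"
  proof -
    have "(\<alpha> + d * recip r) * p = 1 + (\<alpha> * p + (d - 1))"
      using finite by (simp add: algebra_simps)
    then show ?thesis by (simp only: K_def powr_add) (simp add: ennreal_mult)
  qed
  also have "ennreal (2 powr ((\<alpha> + d * recip r) * p)) * suminf ?F
      = ennpowr (ennreal (2 powr (\<alpha> + d * recip r)) * seq_norm d r \<alpha> h) p"
    using finite by (simp add: ennpowr_mult[of "ennreal _"] ennpowr_seq_norm ennpowr_ennreal powr_powr)
  finally show ?thesis
    using finite by (simp add: seq_norm_ennreal_le_iff)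
qed

section \<open>Balls in the graph\<close>

locale beurling_graph =
  fixes V :: "'v set" and E :: "('v \<times> 'v) set" and d D :: real
  assumes simple: "simple_graph V E"
    and connected: "connected_graph V E"
    and density: "beurling_density V E d D"
begin

abbreviation \<rho> :: "'v \<Rightarrow> 'v \<Rightarrow> nat" where "\<rho> \<equiv> geodesic_dist E"

lemma growth: "polynomial_growth V E D d"
  using density by (simp add: beurling_density_def)

lemma D_pos: "0 < D" and d_pos: "0 < d"
  using growth by (auto simp: polynomial_growth_def)

lemma geodesic_le: "(x, y) \<in> E ^^ n \<Longrightarrow> \<rho> x y \<le> n"
  unfolding geodesic_dist_def by (rule Least_le)

lemma geodesic_walk: "x \<in> V \<Longrightarrow> y \<in> V \<Longrightarrow> (x, y) \<in> E ^^ \<rho> x y"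
  using connected unfolding connected_graph_def geodesic_dist_def
  by (metis LeastI_ex rtrancl_power)

lemma geodesic_commute: "\<rho> x y = \<rho> y x"
proof -
  have *: "(y, x) \<in> E ^^ n" if "(x, y) \<in> E ^^ n" for x y n
    using that
  proof (induction n arbitrary: y)
    case (Suc n)
    then obtain z where "(x, z) \<in> E ^^ n" "(z, y) \<in> E" by auto
    moreover have "(y, z) \<in> E"
      using simple \<open>(z, y) \<in> E\<close> by (auto simp: simple_graph_def sym_def)
    ultimately show ?case using Suc.IH by (metis relpow_Suc_I2)
  qed simp
  then have "(x, y) \<in> E ^^ n \<longleftrightarrow> (y, x) \<in> E ^^ n" for n
    by blast
  then show ?thesis unfolding geodesic_dist_def by simp
qed

lemma geodesic_triangle:
  assumes "x \<in> V" "y \<in> V" "z \<in> V"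
  shows "\<rho> x z \<le> \<rho> x y + \<rho> y z"
proof (rule geodesic_le)
  show "(x, z) \<in> E ^^ (\<rho> x y + \<rho> y z)"
    unfolding relpow_add using assms by (blast intro: geodesic_walk)
qed

lemma ball_finite: "x \<in> V \<Longrightarrow> finite {y \<in> V. \<rho> x y \<le> n}" (is "_ \<Longrightarrow> finite ?B")
  and card_ball_le: "x \<in> V \<Longrightarrow> real (card {y \<in> V. \<rho> x y \<le> n}) \<le> D * (real n + 1) powr d"
proof -
  assume "x \<in> V"
  then have "emeasure (count_space V) (graph_ball V E x (real n)) \<le> ennreal (D * (real n + 1) powr d)"
    using growth by (simp add: polynomial_growth_def)
  moreover have "graph_ball V E x (real n) = ?B"
    by (auto simp: graph_ball_def)
  ultimately have *: "emeasure (count_space V) ?B \<le> ennreal (D * (real n + 1) powr d)"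
    by simp
  show fin: "finite ?B"
  \<comment> \<open>The counting measure of an infinite ball would be \<infinity>, which exceeds the
    real growth bound.\<close>
  proof (rule ccontr)
    assume "infinite ?B"
    with * show False by (simp add: emeasure_count_space_infinite top_unique)
  qed
  have "emeasure (count_space V) ?B = ennreal (real (card ?B))"
    using fin by (simp add: emeasure_count_space_finite ennreal_of_nat_eq_real_of_nat)
  with * show "real (card ?B) \<le> D * (real n + 1) powr d"
    using D_pos by (simp add: ennreal_le_iff)
qed

text \<open>On a finite vertex set every positive exponent would be admissible.\<close>

lemma infinite_vertices: "infinite V"
proof
  assume fin: "finite V"
  \<comment> \<open>The exponent d/2 is a positive one below the minimal exponent. Adding 1 to the
    cardinality keeps the constant positive even for an empty vertex set.\<close>
  have "polynomial_growth V E (real (card V) + 1) (d / 2)"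
    unfolding polynomial_growth_def
  proof (intro conjI ballI allI impI)
    fix x R assume "x \<in> V" and R: "0 \<le> (R :: real)"
    have B: "graph_ball V E x R \<subseteq> V" by (auto simp: graph_ball_def)
    then have "emeasure (count_space V) (graph_ball V E x R) = ennreal (real (card (graph_ball V E x R)))"
      using fin by (simp add: finite_subset emeasure_count_space_finite ennreal_of_nat_eq_real_of_nat)
    also have "\<dots> \<le> ennreal ((real (card V) + 1) * (R + 1) powr (d / 2))"
    proof (rule ennreal_leI)
      have "real (card (graph_ball V E x R)) \<le> real (card V) + 1"
        using card_mono[OF fin B] by simp
      also have "\<dots> \<le> (real (card V) + 1) * (R + 1) powr (d / 2)"
        using R d_pos mult_left_mono[OF ge_one_powr_ge_zero[of "R + 1" "d / 2"], of "real (card V) + 1"]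
        by simp
      finally show "real (card (graph_ball V E x R)) \<le> (real (card V) + 1) * (R + 1) powr (d / 2)" .
    qed
    finally show "emeasure (count_space V) (graph_ball V E x R) \<le> ennreal ((real (card V) + 1) * (R + 1) powr (d / 2))" .
  qed (use d_pos in auto)
  then have "d \<le> d / 2"
    using density unfolding beurling_density_def beurling_dimension_def by blast
  with d_pos show False by simp
qed

text \<open>Finite balls cannot exhaust an infinite vertex set, so some vertex has distance at least
  n. Going back along a shortest walk lowers the distance by exactly one per step, so the value n is
  attained.\<close>

lemma sphere_nonempty:
  assumes "x \<in> V"
  shows "\<exists>y\<in>V. \<rho> x y = n"
proof -
  obtain y where y: "y \<in> V" "n \<le> \<rho> x y"
    using finite_subset[OF _ ball_finite[OF assms, of n], of V] infinite_vertices
    by (metis (mono_tags, lifting) mem_Collect_eq nle_le subsetI)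
  from y show ?thesis
  proof (induction "\<rho> x y - n" arbitrary: y)
    case (Suc k)
    then obtain m where m: "\<rho> x y = Suc m" "n \<le> m"
      by (cases "\<rho> x y") auto
    then obtain z where z: "(x, z) \<in> E ^^ m" "(z, y) \<in> E"
      using geodesic_walk[OF assms Suc.prems(1)] by auto
    have zV: "z \<in> V" using z(2) simple by (auto simp: simple_graph_def)
    have "(x, y) \<in> E ^^ Suc (\<rho> x z)"
      using geodesic_walk[OF assms zV] z(2) by auto
    \<comment> \<open>The walk gives distance at most m; a smaller distance to z would bring y
      closer than m + 1.\<close>
    then have "\<rho> x z = m"
      using geodesic_le[of x y "Suc (\<rho> x z)"] geodesic_le[OF z(1)] m by simp
    then show ?case using Suc.hyps m zV by (intro Suc.hyps(1)[of z]) auto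
  qed auto
qed

text \<open>An infinite connected graph has a vertex at every distance, so balls grow at least linearly.\<close>

lemma one_le_d: "1 \<le> d"
proof (rule ccontr)
  assume d: "\<not> 1 \<le> d"
  obtain x where x: "x \<in> V" using infinite_vertices by fastforce
  have "real n + 1 \<le> D * (real n + 1) powr d" for n
  proof -
    obtain y where y: "y m \<in> V" "\<rho> x (y m) = m" for m
      using sphere_nonempty[OF x] by metis
    have "inj y" using y(2) by (metis injI)
    then have "card (y ` {..n}) = Suc n" by (simp add: card_image inj_on_subset)
    moreover have "card (y ` {..n}) \<le> card {z \<in> V. \<rho> x z \<le> n}"
      using y by (intro card_mono ball_finite x) auto
    ultimately show ?thesis
      using card_ball_le[OF x, of n] by simp
  qed
  then have "(real n + 1) powr (1 - d) \<le> D" for n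
    by (simp add: powr_diff pos_divide_le_eq)
  \<comment> \<open>If d < 1, the left side of the preceding bound is unbounded in n; this n makes
    it at least D + 1.\<close>
  moreover obtain n where n: "(D + 1) powr (1 / (1 - d)) < real n"
    using reals_Archimedean2 by blast
  moreover have "((D + 1) powr (1 / (1 - d))) powr (1 - d) \<le> (real n + 1) powr (1 - d)"
    using d n by (intro powr_mono2) auto
  then have "D + 1 \<le> (real n + 1) powr (1 - d)"
    using d D_pos by (simp add: powr_powr)
  ultimately show False by (smt (verit))
qed

end

text \<open>Abel summation: a sum against a decreasing nonnegative h depends monotonically on the
  partial sums. This transfers a bound on balls to weighted sums over spheres.\<close>

lemma sum_mult_le_of_partial_sums_le:
  fixes h s t :: "nat \<Rightarrow> real"
  assumes h: "decseq h" "\<And>n. 0 \<le> h n" and le: "\<And>k. (\<Sum>i\<le>k. s i) \<le> (\<Sum>i\<le>k. t i)"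
  shows "(\<Sum>i\<le>N. h i * s i) \<le> (\<Sum>i\<le>N. h i * t i)"
proof -
  define u where "u i = t i - s i" for i
  have u: "0 \<le> (\<Sum>i\<le>k. u i)" for k
    using le[of k] by (simp add: u_def sum_subtractf)
  \<comment> \<open>This stronger form retains the boundary term of the summation by parts, which
    makes it inductive.\<close>
  have "h N * (\<Sum>i\<le>N. u i) \<le> (\<Sum>i\<le>N. h i * u i)"
  proof (induction N)
    case (Suc N)
    have "h (Suc N) * (\<Sum>i\<le>N. u i) \<le> h N * (\<Sum>i\<le>N. u i)"
      using h(1) u by (intro mult_right_mono) (auto simp: decseq_Suc_iff)
    with Suc show ?case by (simp add: distrib_left)
  qed simp
  moreover have "0 \<le> h N * (\<Sum>i\<le>N. u i)" using h(2) u by simp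
  ultimately show ?thesis by (simp add: u_def sum_subtractf right_diff_distrib)
qed

context beurling_graph
begin

text \<open>Stated for finite sums of reals because summation by parts subtracts. The values
  \<open>s n\<close> count the part of F on each sphere, and \<open>t n\<close> are the increments
  of the ball bound, so that their partial sums telescope to that bound.\<close>

lemma sum_radial_le:
  assumes x: "x \<in> V" and h: "decseq h" "\<And>n. (0::real) \<le> h n" and F: "finite F" "F \<subseteq> V"
    and N: "\<And>y. y \<in> F \<Longrightarrow> \<rho> x y \<le> N"
  shows "(\<Sum>y\<in>F. h (\<rho> x y)) \<le> (\<Sum>n\<le>N. d * D * (h n * (real n + 1) powr (d - 1)))"
proof -
  define s where "s n = real (card {y \<in> F. \<rho> x y = n})" for n
  define t where "t n = D * ((real n + 1) powr d - real n powr d)" for n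
  have partial: "(\<Sum>i\<le>k. s i) \<le> (\<Sum>i\<le>k. t i)" for k
  proof -
    have "(\<Sum>i\<le>k. card {y \<in> F. \<rho> x y = i}) = card (\<Union>i\<le>k. {y \<in> F. \<rho> x y = i})"
      using F by (subst card_UN_disjoint) auto
    also have "\<dots> \<le> card {y \<in> V. \<rho> x y \<le> k}"
      using F by (intro card_mono ball_finite x) auto
    finally have "(\<Sum>i\<le>k. s i) \<le> real (card {y \<in> V. \<rho> x y \<le> k})"
      by (simp add: s_def flip: of_nat_sum)
    also have "\<dots> \<le> D * (real k + 1) powr d"
      by (rule card_ball_le[OF x])
    also have "\<dots> = (\<Sum>i\<le>k. t i)"
      by (induction k) (use d_pos in \<open>auto simp: t_def algebra_simps\<close>)
    finally show ?thesis .
  qed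
  have "(\<Sum>y\<in>F. h (\<rho> x y)) = (\<Sum>n\<le>N. \<Sum>y\<in>{y \<in> F. \<rho> x y = n}. h (\<rho> x y))"
    using F N by (intro sum.group[symmetric]) auto
  also have "\<dots> = (\<Sum>n\<le>N. h n * s n)"
    by (intro sum.cong refl) (auto simp: s_def mult.commute)
  also have "\<dots> \<le> (\<Sum>n\<le>N. h n * t n)"
    by (intro sum_mult_le_of_partial_sums_le h partial)
  also have "\<dots> \<le> (\<Sum>n\<le>N. d * D * (h n * (real n + 1) powr (d - 1)))"
  proof (rule sum_mono)
    fix n
    have "t n \<le> D * (d * (real n + 1) powr (d - 1))"
      unfolding t_def using D_pos one_le_d
      by (intro mult_left_mono powr_diff_le_of_exponent_ge_1) auto
    then have "h n * t n \<le> h n * (D * (d * (real n + 1) powr (d - 1)))"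
      using h(2) by (intro mult_left_mono) auto
    then show "h n * t n \<le> d * D * (h n * (real n + 1) powr (d - 1))"
      by (simp add: ac_simps)
  qed
  finally show ?thesis .
qed

text \<open>A finite norm makes \<open>h 0\<close>, and with it all of the decreasing h, finite; the
  real estimate then applies to every finite subset. Bounding f only through the distance to x lets
  it serve rows and columns alike.\<close>

lemma infsum_radial_le:
  fixes h :: "nat \<Rightarrow> ennreal"
  assumes x: "x \<in> V" and h: "decseq h" and f: "\<And>y. y \<in> V \<Longrightarrow> f y \<le> h (\<rho> x y)"
  shows "(\<Sum>\<^sub>\<infinity>y\<in>V. f y) \<le> ennreal (d * D) * seq_norm d 1 0 h"
proof (cases "seq_norm d 1 0 h = top")
  case True
  then show ?thesis using D_pos d_pos by (simp add: ennreal_mult_top)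
next
  case False
  then have fin: "h n < top" for n
    using seq_norm_at_0_le[of 1 h d 0] h[THEN decseqD, of 0 n] by (auto simp: less_top[symmetric] top_unique)
  define g where "g n = enn2real (h n)" for n
  have hg: "h n = ennreal (g n)" and g0: "0 \<le> g n" for n
    using fin[of n] by (auto simp: g_def)
  have g: "decseq g"
    using h fin unfolding decseq_def g_def by (auto intro!: enn2real_mono)
  show ?thesis
  proof (rule infsum_ennreal_least)
    fix F assume F: "finite F" "F \<subseteq> V"
    define N where "N = Max (\<rho> x ` F)"
    have N: "\<rho> x y \<le> N" if "y \<in> F" for y
      using that F(1) by (simp add: N_def)
    have "sum f F \<le> (\<Sum>y\<in>F. ennreal (g (\<rho> x y)))"
      using f F by (intro sum_mono) (auto simp flip: hg)
    also have "\<dots> = ennreal (\<Sum>y\<in>F. g (\<rho> x y))"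
      using g0 by (intro sum_ennreal)
    also have "\<dots> \<le> ennreal (\<Sum>n\<le>N. d * D * (g n * (real n + 1) powr (d - 1)))"
      by (intro ennreal_leI sum_radial_le x g g0 F N)
    also have "\<dots> = (\<Sum>n\<le>N. ennreal (d * D * (g n * (real n + 1) powr (d - 1))))"
      using g0 D_pos d_pos by (intro sum_ennreal[symmetric]) auto
    also have "\<dots> = (\<Sum>n\<le>N. ennreal (d * D) * (h n * wt (d - 1) n))"
      using g0 D_pos d_pos by (simp add: hg wt_def flip: ennreal_mult)
    also have "\<dots> \<le> (\<Sum>n. ennreal (d * D) * (h n * wt (d - 1) n))"
      by (intro sum_le_suminf) auto
    also have "\<dots> = ennreal (d * D) * seq_norm d 1 0 h"
      by (simp add: seq_norm_1_0)
    finally show "sum f F \<le> ennreal (d * D) * seq_norm d 1 0 h" .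
  qed
qed

section \<open>Off-diagonal suprema and the Schur norm\<close>

lemma entry_le_off_diag_sup:
  assumes "x \<in> V" "y \<in> V" "n \<le> \<rho> x y"
  shows "ennreal (cmod (A x y)) \<le> off_diag_sup V E A n"
  unfolding off_diag_sup_def using assms by (intro SUP_upper2[of "(x, y)"]) auto

lemma off_diag_sup_least:
  assumes "\<And>x y. x \<in> V \<Longrightarrow> y \<in> V \<Longrightarrow> n \<le> \<rho> x y \<Longrightarrow> ennreal (cmod (A x y)) \<le> c"
  shows "off_diag_sup V E A n \<le> c"
  unfolding off_diag_sup_def using assms by (auto intro!: SUP_least)

lemma decseq_off_diag_sup: "decseq (off_diag_sup V E A)"
  unfolding decseq_def by (auto intro!: off_diag_sup_least entry_le_off_diag_sup)

lemma schur_norm_le: "schur_norm V A \<le> ennreal (d * D) * beurling_norm V E d 1 0 A"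
  unfolding schur_norm_def beurling_norm_eq_seq_norm
proof (intro max.boundedI SUP_least infsum_radial_le decseq_off_diag_sup)
  show "ennreal (cmod (A x y)) \<le> off_diag_sup V E A (\<rho> x y)" if "x \<in> V" "y \<in> V" for x y
    using that by (rule entry_le_off_diag_sup) simp
  then show "ennreal (cmod (A x y)) \<le> off_diag_sup V E A (\<rho> y x)" if "y \<in> V" "x \<in> V" for x y
    using that by (simp add: geodesic_commute)
qed

end

section \<open>The Schur test\<close>

text \<open>Bridge from estimates in [0, \<infinity>] to convergence of complex sums: finiteness
  bounds all finite partial sums of the moduli.\<close>

lemma abs_summable_on_if_ennreal:
  fixes g :: "'a \<Rightarrow> complex"
  assumes "(\<Sum>\<^sub>\<infinity>y\<in>V. ennreal (cmod (g y))) < top"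
  shows "(\<lambda>y. cmod (g y)) summable_on V"
proof -
  obtain c where c: "(\<Sum>\<^sub>\<infinity>y\<in>V. ennreal (cmod (g y))) = ennreal c" "0 \<le> c"
    using assms by (cases "\<Sum>\<^sub>\<infinity>y\<in>V. ennreal (cmod (g y))") auto
  have "(\<Sum>y\<in>F. cmod (g y)) \<le> c" if "finite F" "F \<subseteq> V" for F
    using sum_le_infsum_ennreal[OF that, of "\<lambda>y. ennreal (cmod (g y))"] c
    by (simp add: sum_ennreal)
  then show ?thesis
    unfolding abs_summable_iff_bdd_above by (auto intro!: bdd_aboveI2)
qed

lemma infsum_ennreal_cmod:
  assumes "(\<lambda>y. cmod (g y)) summable_on V"
  shows "(\<Sum>\<^sub>\<infinity>y\<in>V. ennreal (cmod (g y))) = ennreal (\<Sum>\<^sub>\<infinity>y\<in>V. cmod (g y))"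
  by (subst infsum_nonneg_is_SUPREMUM_ennreal[OF assms])
    (auto simp: nonneg_infsum_complete sum_ennreal)

text \<open>An infinite right side leaves nothing to show, and a finite one gives absolute
  convergence. Products and operator images can thus be estimated before their convergence is
  discussed.\<close>

lemma ennreal_cmod_infsum_le:
  "ennreal (cmod (\<Sum>\<^sub>\<infinity>y\<in>V. g y)) \<le> (\<Sum>\<^sub>\<infinity>y\<in>V. ennreal (cmod (g y)))"
proof (cases "(\<Sum>\<^sub>\<infinity>y\<in>V. ennreal (cmod (g y))) < top")
  case True
  then show ?thesis
    using norm_infsum_bound[OF abs_summable_on_if_ennreal[OF True]]
    by (simp add: infsum_ennreal_cmod[OF abs_summable_on_if_ennreal[OF True]] ennreal_leI)
qed (simp add: less_top[symmetric])

lemma schur_norm_row: "x \<in> V \<Longrightarrow> (\<Sum>\<^sub>\<infinity>y\<in>V. ennreal (cmod (A x y))) \<le> schur_norm V A"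
  unfolding schur_norm_def by (rule max.coboundedI1, rule SUP_upper)

lemma schur_norm_column: "y \<in> V \<Longrightarrow> (\<Sum>\<^sub>\<infinity>x\<in>V. ennreal (cmod (A x y))) \<le> schur_norm V A"
  unfolding schur_norm_def
  by (rule max.coboundedI2, rule SUP_upper)

lemma lq_norm_ennreal:
  assumes "1 \<le> p"
  shows "lq_norm V (ennreal p) f = ennpowr (\<Sum>\<^sub>\<infinity>x\<in>V. ennpowr (ennreal (cmod (f x))) p) (1 / p)"
  using assms by (simp add: lq_norm_def recip_ennreal ennpowr_ennreal)

lemma lq_norm_top: "lq_norm V top f = (SUP x\<in>V. ennreal (cmod (f x)))"
  by (simp add: lq_norm_def)

lemma le_lq_norm:
  assumes "1 \<le> q" "x \<in> V"
  shows "ennreal (cmod (f x)) \<le> lq_norm V q f"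
  using assms(1)
proof (cases q rule: exponent_cases)
  case top
  then show ?thesis using assms(2) by (auto simp: lq_norm_top intro: SUP_upper)
next
  case (finite p)
  then show ?thesis
    using le_infsum_ennreal[OF assms(2), of "\<lambda>x. ennpowr (ennreal (cmod (f x))) p"]
    by (simp add: lq_norm_ennreal flip: ennpowr_le_iff_right)
qed

lemma infsum_mult_le:
  fixes a f :: "'a \<Rightarrow> ennreal"
  assumes "\<And>y. y \<in> V \<Longrightarrow> f y \<le> c"
  shows "(\<Sum>\<^sub>\<infinity>y\<in>V. f y * a y) \<le> c * (\<Sum>\<^sub>\<infinity>y\<in>V. a y)"
proof -
  have "(\<Sum>\<^sub>\<infinity>y\<in>V. f y * a y) \<le> (\<Sum>\<^sub>\<infinity>y\<in>V. c * a y)"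
    using assms by (intro infsum_mono_ennreal mult_right_mono) auto
  then show ?thesis by (simp only: infsum_cmult_ennreal)
qed

text \<open>Schur's test: Jensen's inequality in each row, whose mass is at most S, costs S to the
  power p - 1; after interchanging the sums the columns contribute the last factor S.\<close>

lemma infsum_ennpowr_schur_le:
  fixes a :: "'a \<Rightarrow> 'a \<Rightarrow> ennreal"
  assumes p: "1 \<le> p" and S: "S < top"
    and row: "\<And>x. x \<in> V \<Longrightarrow> (\<Sum>\<^sub>\<infinity>y\<in>V. a x y) \<le> S"
    and column: "\<And>y. y \<in> V \<Longrightarrow> (\<Sum>\<^sub>\<infinity>x\<in>V. a x y) \<le> S"
  shows "(\<Sum>\<^sub>\<infinity>x\<in>V. ennpowr (\<Sum>\<^sub>\<infinity>y\<in>V. f y * a x y) p) \<le> ennpowr S p * (\<Sum>\<^sub>\<infinity>y\<in>V. ennpowr (f y) p)"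
proof -
  \<comment> \<open>For p = 1 the row estimate is an identity with factor 1, whereas
    \<open>ennpowr S 0\<close> would be 0 at S = 0.\<close>
  define K where "K = (if p = 1 then 1 else ennpowr S (p - 1))"
  have K: "K * S = ennpowr S p"
    using ennpowr_add[of S "p - 1" 1] by (cases "p = 1") (auto simp: K_def)
  have "ennpowr (\<Sum>\<^sub>\<infinity>y\<in>V. f y * a x y) p \<le> K * (\<Sum>\<^sub>\<infinity>y\<in>V. ennpowr (f y) p * a x y)" if "x \<in> V" for x
  proof (cases "p = 1")
    case False
    have "ennpowr (\<Sum>\<^sub>\<infinity>y\<in>V. f y * a x y) p
        \<le> ennpowr (\<Sum>\<^sub>\<infinity>y\<in>V. a x y) (p - 1) * (\<Sum>\<^sub>\<infinity>y\<in>V. ennpowr (f y) p * a x y)"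
      using p False row[OF that] S by (intro ennpowr_infsum_weighted) auto
    also have "\<dots> \<le> K * (\<Sum>\<^sub>\<infinity>y\<in>V. ennpowr (f y) p * a x y)"
      using p False row[OF that] by (auto simp: K_def intro!: mult_right_mono ennpowr_mono)
    finally show ?thesis .
  qed (simp add: K_def)
  then have "(\<Sum>\<^sub>\<infinity>x\<in>V. ennpowr (\<Sum>\<^sub>\<infinity>y\<in>V. f y * a x y) p)
      \<le> (\<Sum>\<^sub>\<infinity>x\<in>V. K * (\<Sum>\<^sub>\<infinity>y\<in>V. ennpowr (f y) p * a x y))"
    by (rule infsum_mono_ennreal)
  also have "\<dots> = K * (\<Sum>\<^sub>\<infinity>y\<in>V. ennpowr (f y) p * (\<Sum>\<^sub>\<infinity>x\<in>V. a x y))"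
    by (subst infsum_cmult_ennreal, subst infsum_swap_ennreal) (simp add: infsum_cmult_ennreal)
  also have "\<dots> \<le> K * (\<Sum>\<^sub>\<infinity>y\<in>V. ennpowr (f y) p * S)"
    using column by (intro mult_left_mono infsum_mono_ennreal) auto
  also have "\<dots> = K * (S * (\<Sum>\<^sub>\<infinity>y\<in>V. ennpowr (f y) p))"
    by (simp add: mult.commute flip: infsum_cmult_ennreal)
  also have "\<dots> = ennpowr S p * (\<Sum>\<^sub>\<infinity>y\<in>V. ennpowr (f y) p)"
    by (simp only: mult.assoc[symmetric] K)
  finally show ?thesis .
qed

section \<open>Matrices of finite Schur norm as operators on \<open>\<ell>\<^sup>q\<close>\<close>

context
  fixes V :: "'v set" and q :: ennreal and A :: "'v \<Rightarrow> 'v \<Rightarrow> complex"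
  assumes q: "1 \<le> q" and A: "A \<in> schur_class V"
begin

lemma schur_finite: "schur_norm V A < top"
  using A by (simp add: schur_class_def)

lemma row_abs_summable:
  assumes "x \<in> V" "f \<in> lq_space V q"
  shows "(\<lambda>y. cmod (A x y * f y)) summable_on V"
proof (rule abs_summable_on_if_ennreal)
  have "(\<Sum>\<^sub>\<infinity>y\<in>V. ennreal (cmod (A x y * f y))) = (\<Sum>\<^sub>\<infinity>y\<in>V. ennreal (cmod (f y)) * ennreal (cmod (A x y)))"
    by (simp add: norm_mult mult.commute flip: ennreal_mult)
  also have "\<dots> \<le> lq_norm V q f * (\<Sum>\<^sub>\<infinity>y\<in>V. ennreal (cmod (A x y)))"
    by (intro infsum_mult_le le_lq_norm q)
  also have "\<dots> < top"
    using assms schur_norm_row[OF assms(1), of A] schur_finite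
    by (auto simp: lq_space_def ennreal_mult_less_top)
  finally show "(\<Sum>\<^sub>\<infinity>y\<in>V. ennreal (cmod (A x y * f y))) < top" .
qed

lemma row_summable: "x \<in> V \<Longrightarrow> f \<in> lq_space V q \<Longrightarrow> (\<lambda>y. A x y * f y) summable_on V"
  by (rule abs_summable_summable[OF row_abs_summable])

lemma mat_op_outside: "x \<notin> V \<Longrightarrow> mat_op V A f x = 0"
  using A by (simp add: mat_op_def schur_class_def matrices_def)

lemma lq_norm_mat_op_le: "lq_norm V q (mat_op V A f) \<le> schur_norm V A * lq_norm V q f"
proof -
  have le: "ennreal (cmod (mat_op V A f x)) \<le> (\<Sum>\<^sub>\<infinity>y\<in>V. ennreal (cmod (f y)) * ennreal (cmod (A x y)))" for x
    using ennreal_cmod_infsum_le[of "\<lambda>y. A x y * f y" V]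
    by (simp add: mat_op_def norm_mult mult.commute flip: ennreal_mult)
  from q show ?thesis
  proof (cases q rule: exponent_cases)
    case top
    have "ennreal (cmod (mat_op V A f x)) \<le> schur_norm V A * lq_norm V q f" if "x \<in> V" for x
    proof -
      have "ennreal (cmod (mat_op V A f x)) \<le> lq_norm V q f * (\<Sum>\<^sub>\<infinity>y\<in>V. ennreal (cmod (A x y)))"
        by (rule order_trans[OF le]) (intro infsum_mult_le le_lq_norm q)
      also have "\<dots> \<le> lq_norm V q f * schur_norm V A"
        by (intro mult_left_mono schur_norm_row that) simp
      finally show ?thesis by (simp add: mult.commute)
    qed
    then show ?thesis by (simp add: lq_norm_top[of V "mat_op V A f"] top SUP_le_iff)
  next
    case (finite p)
    have "(\<Sum>\<^sub>\<infinity>x\<in>V. ennpowr (ennreal (cmod (mat_op V A f x))) p)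
        \<le> (\<Sum>\<^sub>\<infinity>x\<in>V. ennpowr (\<Sum>\<^sub>\<infinity>y\<in>V. ennreal (cmod (f y)) * ennreal (cmod (A x y))) p)"
      using finite by (intro infsum_mono_ennreal ennpowr_mono le) auto
    also have "\<dots> \<le> ennpowr (schur_norm V A) p * (\<Sum>\<^sub>\<infinity>y\<in>V. ennpowr (ennreal (cmod (f y))) p)"
      by (intro infsum_ennpowr_schur_le finite schur_finite schur_norm_row schur_norm_column)
    also have "\<dots> = ennpowr (schur_norm V A * lq_norm V q f) p"
      using finite by (simp add: ennpowr_mult lq_norm_ennreal ennpowr_powr)
    finally show ?thesis
      using finite by (simp add: lq_norm_ennreal[of p V "mat_op V A f"] ennpowr_le_iff_left)
  qed
qed

lemma schur_subset_bounded_op_matrices: "A \<in> bounded_op_matrices V q"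
proof -
  have "mat_op V A f \<in> lq_space V q" if "f \<in> lq_space V q" for f
  proof -
    have "schur_norm V A * lq_norm V q f < top"
      using that schur_finite by (simp add: lq_space_def ennreal_mult_less_top)
    then show ?thesis
      using lq_norm_mat_op_le[of f] by (auto simp: lq_space_def mat_op_outside)
  qed
  moreover have "mat_op V A (f + g) = mat_op V A f + mat_op V A g"
    if "f \<in> lq_space V q" "g \<in> lq_space V q" for f g
  proof
    show "mat_op V A (f + g) x = (mat_op V A f + mat_op V A g) x" for x
    proof (cases "x \<in> V")
      case True
      then show ?thesis
        \<comment> \<open>Additivity rests on convergence of both row sums, since a divergent
          \<open>infsum\<close> has the default value 0.\<close>
        using infsum_add[OF row_summable row_summable, OF True that(1) True that(2)]
        by (simp add: mat_op_def distrib_left)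
    qed (simp add: mat_op_outside)
  qed
  moreover have "mat_op V A (\<lambda>x. c * f x) = (\<lambda>x. c * mat_op V A f x)" for c f
    by (simp add: mat_op_def mult.left_commute[of _ c] infsum_cmult_right')
  moreover have "\<exists>C::real. \<forall>f\<in>lq_space V q. lq_norm V q (mat_op V A f) \<le> ennreal C * lq_norm V q f"
    using lq_norm_mat_op_le schur_finite by (intro exI[of _ "enn2real (schur_norm V A)"]) simp
  ultimately show ?thesis
    using A row_summable by (auto simp: bounded_op_matrices_def bounded_ops_def schur_class_def)
qed

lemma op_norm_le_schur_norm: "op_norm V q (mat_op V A) \<le> schur_norm V A"
  unfolding op_norm_def
proof (rule SUP_least)
  fix f assume f: "f \<in> {f \<in> lq_space V q. lq_norm V q f \<le> 1}"
  have "lq_norm V q (mat_op V A f) \<le> schur_norm V A * lq_norm V q f"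
    by (rule lq_norm_mat_op_le)
  also have "\<dots> \<le> schur_norm V A * 1"
    by (rule mult_left_mono) (use f in blast, rule zero_le)
  finally show "lq_norm V q (mat_op V A f) \<le> schur_norm V A"
    by (simp only: mult_1_right)
qed

end

section \<open>The Beurling algebra\<close>

lemma vector_space_mat_scale: "vector_space mat_scale"
  by (simp add: vector_space_def mat_scale_def fun_eq_iff algebra_simps)

context beurling_graph
begin

text \<open>Covers two claims at once: equal weight exponents give solidity, equal matrices give the
  monotonicity in \<alpha>.\<close>

lemma beurling_norm_mono:
  assumes "1 \<le> r" "\<alpha> \<le> \<beta>" "\<And>x y. x \<in> V \<Longrightarrow> y \<in> V \<Longrightarrow> cmod (A x y) \<le> cmod (B x y)"
  shows "beurling_norm V E d r \<alpha> A \<le> beurling_norm V E d r \<beta> B"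
  unfolding beurling_norm_eq_seq_norm
proof (intro seq_norm_mono assms(1,2) off_diag_sup_least)
  fix n x y assume xy: "x \<in> V" "y \<in> V" "n \<le> \<rho> x y"
  then have "ennreal (cmod (A x y)) \<le> ennreal (cmod (B x y))"
    using assms(3) by (intro ennreal_leI) auto
  also have "\<dots> \<le> off_diag_sup V E B n"
    by (rule entry_le_off_diag_sup[OF xy])
  finally show "ennreal (cmod (A x y)) \<le> off_diag_sup V E B n" .
qed

lemma beurling_norm_add_le:
  assumes "1 \<le> r"
  shows "beurling_norm V E d r \<alpha> (A + B) \<le> beurling_norm V E d r \<alpha> A + beurling_norm V E d r \<alpha> B"
proof -
  have "off_diag_sup V E (A + B) n \<le> off_diag_sup V E A n + off_diag_sup V E B n" for n
  proof (rule off_diag_sup_least)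
    fix x y assume xy: "x \<in> V" "y \<in> V" "n \<le> \<rho> x y"
    have "ennreal (cmod ((A + B) x y)) \<le> ennreal (cmod (A x y)) + ennreal (cmod (B x y))"
      by (simp add: norm_triangle_ineq ennreal_leI flip: ennreal_plus)
    also have "\<dots> \<le> off_diag_sup V E A n + off_diag_sup V E B n"
      using xy by (intro add_mono entry_le_off_diag_sup)
    finally show "ennreal (cmod ((A + B) x y)) \<le> off_diag_sup V E A n + off_diag_sup V E B n" .
  qed
  then show ?thesis
    unfolding beurling_norm_eq_seq_norm
    by (intro order_trans[OF seq_norm_mono seq_norm_add_le] assms order_refl)
qed

lemma beurling_norm_mat_scale:
  assumes "1 \<le> r"
  shows "beurling_norm V E d r \<alpha> (mat_scale c A) = ennreal (cmod c) * beurling_norm V E d r \<alpha> A"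
proof -
  have "off_diag_sup V E (mat_scale c A) n = ennreal (cmod c) * off_diag_sup V E A n" for n
    unfolding off_diag_sup_def mat_scale_def
    by (simp add: SUP_mult_left_ennreal norm_mult ennreal_mult case_prod_unfold)
  then have "off_diag_sup V E (mat_scale c A) = (\<lambda>n. ennreal (cmod c) * off_diag_sup V E A n)"
    by (rule ext)
  then show ?thesis
    using seq_norm_cmult[OF assms] by (simp add: beurling_norm_eq_seq_norm)
qed

lemma beurling_norm_minus_commute:
  assumes "1 \<le> r"
  shows "beurling_norm V E d r \<alpha> (A - B) = beurling_norm V E d r \<alpha> (B - A)"
  using assms by (intro antisym beurling_norm_mono) (auto simp: norm_minus_commute)

lemma entry_le_beurling_norm:
  assumes "1 \<le> r" "x \<in> V" "y \<in> V"
  shows "ennreal (cmod (A x y)) \<le> beurling_norm V E d r \<alpha> A"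
  unfolding beurling_norm_eq_seq_norm
  by (rule order_trans[OF entry_le_off_diag_sup seq_norm_at_0_le]) (use assms in auto)

text \<open>If z is a third vertex, one of the two steps from x to z and from z to y has at least half
  the length of the way from x to y.\<close>

lemma off_diag_sup_mat_mult_le:
  "off_diag_sup V E (mat_mult V A B) n
    \<le> schur_norm V B * off_diag_sup V E A (Suc n div 2) + schur_norm V A * off_diag_sup V E B (Suc n div 2)"
    (is "_ \<le> schur_norm V B * ?a + schur_norm V A * ?b")
proof (rule off_diag_sup_least)
  fix x y assume xy: "x \<in> V" "y \<in> V" "n \<le> \<rho> x y"
  have le: "ennreal (cmod (A x z * B z y)) \<le> ?a * ennreal (cmod (B z y)) + ?b * ennreal (cmod (A x z))"
    if z: "z \<in> V" for z
  proof -
    \<comment> \<open>Two naturals both below n/2 rounded up have a sum of at most n - 1, against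
      the triangle inequality.\<close>
    have "Suc n div 2 \<le> \<rho> x z \<or> Suc n div 2 \<le> \<rho> z y"
      using geodesic_triangle[OF xy(1) z xy(2)] xy(3) by linarith
    then show ?thesis
    proof
      assume "Suc n div 2 \<le> \<rho> x z"
      then have "ennreal (cmod (A x z)) * ennreal (cmod (B z y)) \<le> ?a * ennreal (cmod (B z y))"
        using xy z by (intro mult_right_mono entry_le_off_diag_sup) auto
      then show ?thesis by (simp add: norm_mult ennreal_mult add_increasing2)
    next
      assume "Suc n div 2 \<le> \<rho> z y"
      then have "ennreal (cmod (B z y)) * ennreal (cmod (A x z)) \<le> ?b * ennreal (cmod (A x z))"
        using xy z by (intro mult_right_mono entry_le_off_diag_sup) auto
      then show ?thesis by (simp add: norm_mult ennreal_mult mult.commute add_increasing)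
    qed
  qed
  have "ennreal (cmod (mat_mult V A B x y)) \<le> (\<Sum>\<^sub>\<infinity>z\<in>V. ennreal (cmod (A x z * B z y)))"
    unfolding mat_mult_def by (rule ennreal_cmod_infsum_le)
  also have "\<dots> \<le> (\<Sum>\<^sub>\<infinity>z\<in>V. ?a * ennreal (cmod (B z y)) + ?b * ennreal (cmod (A x z)))"
    by (rule infsum_mono_ennreal[OF le])
  also have "\<dots> = ?a * (\<Sum>\<^sub>\<infinity>z\<in>V. ennreal (cmod (B z y))) + ?b * (\<Sum>\<^sub>\<infinity>z\<in>V. ennreal (cmod (A x z)))"
    by (simp add: infsum_add_ennreal infsum_cmult_ennreal)
  also have "\<dots> \<le> ?a * schur_norm V B + ?b * schur_norm V A"
    using xy by (intro add_mono mult_left_mono schur_norm_row schur_norm_column) auto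
  finally show "ennreal (cmod (mat_mult V A B x y)) \<le> schur_norm V B * ?a + schur_norm V A * ?b"
    by (simp add: mult.commute)
qed

lemma beurling_norm_mat_mult_le:
  assumes "1 \<le> r" "0 \<le> \<alpha>"
  shows "beurling_norm V E d r \<alpha> (mat_mult V A B) \<le> ennreal (2 powr (\<alpha> + d * recip r)) *
    (schur_norm V B * beurling_norm V E d r \<alpha> A + schur_norm V A * beurling_norm V E d r \<alpha> B)"
proof -
  let ?a = "off_diag_sup V E A" and ?b = "off_diag_sup V E B" and ?K = "ennreal (2 powr (\<alpha> + d * recip r))"
  have "beurling_norm V E d r \<alpha> (mat_mult V A B)
    \<le> seq_norm d r \<alpha> (\<lambda>n. schur_norm V B * ?a (Suc n div 2) + schur_norm V A * ?b (Suc n div 2))"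
    unfolding beurling_norm_eq_seq_norm
    by (intro seq_norm_mono assms order_refl off_diag_sup_mat_mult_le)
  also have "\<dots> \<le> seq_norm d r \<alpha> (\<lambda>n. schur_norm V B * ?a (Suc n div 2))
      + seq_norm d r \<alpha> (\<lambda>n. schur_norm V A * ?b (Suc n div 2))"
    by (rule seq_norm_add_le[OF assms(1)])
  also have "\<dots> = schur_norm V B * seq_norm d r \<alpha> (\<lambda>n. ?a (Suc n div 2))
      + schur_norm V A * seq_norm d r \<alpha> (\<lambda>n. ?b (Suc n div 2))"
    by (simp only: seq_norm_cmult[OF assms(1)])
  also have "\<dots> \<le> schur_norm V B * (?K * seq_norm d r \<alpha> ?a) + schur_norm V A * (?K * seq_norm d r \<alpha> ?b)"
    by (intro add_mono mult_left_mono seq_norm_half_le assms one_le_d) auto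
  also have "\<dots> = ?K * (schur_norm V B * seq_norm d r \<alpha> ?a + schur_norm V A * seq_norm d r \<alpha> ?b)"
    by (simp add: distrib_left ac_simps)
  finally show ?thesis by (simp only: beurling_norm_eq_seq_norm)
qed

text \<open>The constant of \<open>seq_norm_embedding\<close> for passing from exponent r and weight
  \<alpha> to exponent 1 and weight 0.\<close>

definition algebra_const :: "ennreal \<Rightarrow> real \<Rightarrow> real" where
  "algebra_const r \<alpha> = ((\<alpha> - (d - 1) * (1 - recip r)) / (\<alpha> - d * (1 - recip r))) powr (1 - recip r)"

lemma schur_norm_le_beurling_norm:
  assumes "1 \<le> r" "d * (1 - recip r) < \<alpha>"
  shows "schur_norm V A \<le> ennreal (d * D * algebra_const r \<alpha>) * beurling_norm V E d r \<alpha> A"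
proof -
  have "recip 1 = 1" using recip_ennreal[of 1] by simp
  then have "beurling_norm V E d 1 0 A \<le> ennreal (algebra_const r \<alpha>) * beurling_norm V E d r \<alpha> A"
    using seq_norm_embedding[of 1 r 0 d \<alpha>] assms
    by (simp add: beurling_norm_eq_seq_norm algebra_const_def)
  then have "ennreal (d * D) * beurling_norm V E d 1 0 A
      \<le> ennreal (d * D) * (ennreal (algebra_const r \<alpha>) * beurling_norm V E d r \<alpha> A)"
    by (rule mult_left_mono) simp
  also have "\<dots> = ennreal (d * D * algebra_const r \<alpha>) * beurling_norm V E d r \<alpha> A"
    using d_pos D_pos by (simp add: algebra_const_def ennreal_mult mult.assoc)
  finally show ?thesis using schur_norm_le[of A] by (rule order_trans[rotated])
qed

lemma schur_sum_le:
  assumes "1 \<le> r" "d * (1 - recip r) < \<alpha>"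
  shows "ennreal (2 powr (\<alpha> + d * recip r)) *
      (schur_norm V B * beurling_norm V E d r \<alpha> A + schur_norm V A * beurling_norm V E d r \<alpha> B)
    \<le> ennreal (2 powr (\<alpha> + 1 + d * recip r) * d * D * algebra_const r \<alpha>)
      * beurling_norm V E d r \<alpha> A * beurling_norm V E d r \<alpha> B"
proof -
  let ?a = "beurling_norm V E d r \<alpha> A" and ?b = "beurling_norm V E d r \<alpha> B"
  let ?c = "ennreal (d * D * algebra_const r \<alpha>)" and ?K = "ennreal (2 powr (\<alpha> + d * recip r))"
  have c: "0 \<le> d * D * algebra_const r \<alpha>"
    using d_pos D_pos by (simp add: algebra_const_def)
  have "?K * (schur_norm V B * ?a + schur_norm V A * ?b) \<le> ?K * (?c * ?b * ?a + ?c * ?a * ?b)"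
    by (intro mult_left_mono add_mono mult_right_mono schur_norm_le_beurling_norm assms) auto
  \<comment> \<open>The two summands obey the same bound; their factor 2 raises the exponent
    \<alpha> to \<alpha> + 1.\<close>
  also have "\<dots> = (2 * ?K * ?c) * ?a * ?b"
    by (simp add: mult_2 distrib_left distrib_right ac_simps)
  also have "2 * ?K * ?c = ennreal (2 * 2 powr (\<alpha> + d * recip r) * (d * D * algebra_const r \<alpha>))"
    using c by (simp add: ennreal_mult)
  also have "2 * 2 powr (\<alpha> + d * recip r) * (d * D * algebra_const r \<alpha>)
      = 2 powr (\<alpha> + 1 + d * recip r) * d * D * algebra_const r \<alpha>"
    by (simp add: powr_add ac_simps)
  finally show ?thesis .
qed

text \<open>Fatou's lemma: the norm is lower semicontinuous under entrywise convergence. The infima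
  \<open>g m\<close> of the off-diagonal suprema over k \<ge> m increase with m, have norm at most
  c, and their supremum dominates the off-diagonal suprema of the limit.\<close>

lemma beurling_norm_lim_le:
  assumes r: "1 \<le> r" and lim: "\<And>x y. x \<in> V \<Longrightarrow> y \<in> V \<Longrightarrow> (\<lambda>k. F k x y) \<longlonglongrightarrow> G x y"
    and F: "\<And>k. beurling_norm V E d r \<alpha> (F k) \<le> c"
  shows "beurling_norm V E d r \<alpha> G \<le> c"
proof -
  define g where "g m n = (INF k\<in>{m..}. off_diag_sup V E (F k) n)" for m n
  have "off_diag_sup V E G n \<le> (SUP m. g m n)" for n
  proof (rule off_diag_sup_least)
    fix x y assume xy: "x \<in> V" "y \<in> V" "n \<le> \<rho> x y"
    have "(\<lambda>k. ennreal (cmod (F k x y))) \<longlonglongrightarrow> ennreal (cmod (G x y))"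
      using xy by (intro tendsto_ennrealI tendsto_norm lim)
    then have "ennreal (cmod (G x y)) = liminf (\<lambda>k. ennreal (cmod (F k x y)))"
      by (rule lim_imp_Liminf[OF sequentially_bot, symmetric])
    also have "\<dots> = (SUP m. INF k\<in>{m..}. ennreal (cmod (F k x y)))"
      by (rule liminf_SUP_INF)
    also have "\<dots> \<le> (SUP m. g m n)"
      unfolding g_def using xy by (intro SUP_mono' INF_mono') (auto intro: entry_le_off_diag_sup)
    finally show "ennreal (cmod (G x y)) \<le> (SUP m. g m n)" .
  qed
  then have "beurling_norm V E d r \<alpha> G \<le> seq_norm d r \<alpha> (\<lambda>n. SUP m. g m n)"
    unfolding beurling_norm_eq_seq_norm by (intro seq_norm_mono r order_refl)
  also have "\<dots> \<le> c"
  proof (rule seq_norm_SUP_le[OF r])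
    show "incseq (\<lambda>m. g m n)" for n
      unfolding g_def incseq_def by (auto intro!: INF_superset_mono)
    have "seq_norm d r \<alpha> (g m) \<le> beurling_norm V E d r \<alpha> (F m)" for m
      unfolding beurling_norm_eq_seq_norm g_def
      by (intro seq_norm_mono r order_refl INF_lower) auto
    then show "seq_norm d r \<alpha> (g m) \<le> c" for m
      using F order_trans by blast
  qed
  finally show ?thesis .
qed

section \<open>The algebra structure for \<alpha> > d (1 - 1/r)\<close>

context
  fixes r :: ennreal and \<alpha> :: real
  assumes r: "1 \<le> r" and \<alpha>: "0 \<le> \<alpha>" "d * (1 - recip r) < \<alpha>"
begin

abbreviation "\<A> \<equiv> beurling_class V E d r \<alpha>"
abbreviation "nrm A \<equiv> enn2real (beurling_norm V E d r \<alpha> A)"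

lemma class_matrices: "A \<in> \<A> \<Longrightarrow> A \<in> matrices V"
  and norm_finite: "A \<in> \<A> \<Longrightarrow> beurling_norm V E d r \<alpha> A < top"
  by (auto simp: beurling_class_def)

lemma ennreal_nrm: "A \<in> \<A> \<Longrightarrow> ennreal (nrm A) = beurling_norm V E d r \<alpha> A"
  using norm_finite by simp

lemma schur_norm_finite: "A \<in> \<A> \<Longrightarrow> schur_norm V A < top"
  using schur_norm_le_beurling_norm[OF r \<alpha>(2), of A] norm_finite[of A]
  by (auto simp: ennreal_mult_less_top intro: le_less_trans)

lemma entry_zero: "A \<in> \<A> \<Longrightarrow> x \<notin> V \<or> y \<notin> V \<Longrightarrow> A x y = 0"
  using class_matrices by (auto simp: matrices_def)

lemma add_closed:
  assumes "A \<in> \<A>" "B \<in> \<A>"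
  shows "A + B \<in> \<A>"
proof -
  have "beurling_norm V E d r \<alpha> A + beurling_norm V E d r \<alpha> B < top"
    using assms norm_finite by simp
  then show ?thesis
    using beurling_norm_add_le[OF r, of \<alpha> A B] assms
    by (auto simp: beurling_class_def matrices_def intro: le_less_trans)
qed

lemma scale_closed: "A \<in> \<A> \<Longrightarrow> mat_scale c A \<in> \<A>"
  by (auto simp: beurling_class_def beurling_norm_mat_scale[OF r] ennreal_mult_less_top)
    (auto simp: matrices_def mat_scale_def)

lemma diff_closed: "A \<in> \<A> \<Longrightarrow> B \<in> \<A> \<Longrightarrow> A - B \<in> \<A>"
proof -
  assume "A \<in> \<A>" "B \<in> \<A>"
  then have "A + mat_scale (-1) B \<in> \<A>" by (intro add_closed scale_closed)
  moreover have "A + mat_scale (-1) B = A - B" by (simp add: mat_scale_def fun_eq_iff)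
  ultimately show ?thesis by simp
qed

lemma zero_closed: "0 \<in> \<A>"
proof -
  have "beurling_norm V E d r \<alpha> 0 = 0"
    using beurling_norm_mat_scale[OF r, of \<alpha> 0 0] by (simp add: mat_scale_def zero_fun_def)
  then show ?thesis by (simp add: beurling_class_def matrices_def)
qed

lemma subspace_class: "module.subspace mat_scale \<A>"
proof -
  interpret vector_space mat_scale by (rule vector_space_mat_scale)
  show ?thesis
    unfolding subspace_def using zero_closed add_closed scale_closed by blast
qed

lemma mult_closed:
  assumes "A \<in> \<A>" "B \<in> \<A>"
  shows "mat_mult V A B \<in> \<A>"
proof -
  have "ennreal (2 powr (\<alpha> + d * recip r)) *
    (schur_norm V B * beurling_norm V E d r \<alpha> A + schur_norm V A * beurling_norm V E d r \<alpha> B) < top"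
    using assms norm_finite schur_norm_finite by (simp add: ennreal_mult_less_top)
  moreover have "mat_mult V A B \<in> matrices V"
    using entry_zero[OF assms(1)] entry_zero[OF assms(2)]
    by (auto simp: matrices_def mat_mult_def intro!: infsum_0)
  ultimately show ?thesis
    using beurling_norm_mat_mult_le[OF r \<alpha>(1), of A B] by (simp add: beurling_class_def)
qed

lemma mult_summable:
  assumes "A \<in> \<A>" "B \<in> \<A>"
  shows "(\<lambda>z. A x z * B z y) summable_on V"
proof (cases "x \<in> V \<and> y \<in> V")
  case True
  have "(\<Sum>\<^sub>\<infinity>z\<in>V. ennreal (cmod (A x z * B z y)))
      = (\<Sum>\<^sub>\<infinity>z\<in>V. ennreal (cmod (B z y)) * ennreal (cmod (A x z)))"
    by (simp add: norm_mult ennreal_mult mult.commute)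
  also have "\<dots> \<le> beurling_norm V E d r \<alpha> B * (\<Sum>\<^sub>\<infinity>z\<in>V. ennreal (cmod (A x z)))"
    using True by (intro infsum_mult_le entry_le_beurling_norm r) auto
  also have "\<dots> \<le> beurling_norm V E d r \<alpha> B * schur_norm V A"
    using True by (intro mult_left_mono schur_norm_row) auto
  also have "\<dots> < top"
    using assms norm_finite schur_norm_finite by (simp add: ennreal_mult_less_top)
  finally show ?thesis
    by (rule abs_summable_summable[OF abs_summable_on_if_ennreal])
next
  case False
  then have "A x z * B z y = 0" for z
    using entry_zero[OF assms(1), of x z] entry_zero[OF assms(2), of z y] by auto
  then show ?thesis by (intro summable_on_0)
qed

text \<open>Fubini's theorem for the double sum over intermediate vertices. Absolute summability
  over pairs holds because the entries of C are bounded while the rows of A and B are summable with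
  uniform bounds.\<close>

lemma mult_assoc:
  assumes "A \<in> \<A>" "B \<in> \<A>" "C \<in> \<A>"
  shows "mat_mult V (mat_mult V A B) C = mat_mult V A (mat_mult V B C)"
proof (intro ext)
  fix x y
  show "mat_mult V (mat_mult V A B) C x y = mat_mult V A (mat_mult V B C) x y"
  proof (cases "x \<in> V \<and> y \<in> V")
    case True
    let ?f = "\<lambda>w z. A x w * B w z * C z y"
    have "(\<Sum>\<^sub>\<infinity>(w, z)\<in>V \<times> V. ennreal (cmod (?f w z)))
        \<le> (\<Sum>\<^sub>\<infinity>w\<in>V. \<Sum>\<^sub>\<infinity>z\<in>V. ennreal (cmod (?f w z)))"
      by (rule infsum_Times_le_ennreal)
    also have "\<dots> = (\<Sum>\<^sub>\<infinity>w\<in>V. ennreal (cmod (A x w)) * (\<Sum>\<^sub>\<infinity>z\<in>V. ennreal (cmod (C z y)) * ennreal (cmod (B w z))))"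
      by (simp add: norm_mult ennreal_mult mult.assoc infsum_cmult_ennreal mult.commute[of "ennreal (cmod (C _ y))"])
    also have "\<dots> \<le> (\<Sum>\<^sub>\<infinity>w\<in>V. ennreal (cmod (A x w)) * (beurling_norm V E d r \<alpha> C * schur_norm V B))"
    proof (intro infsum_mono_ennreal mult_left_mono)
      fix w assume "w \<in> V"
      have "(\<Sum>\<^sub>\<infinity>z\<in>V. ennreal (cmod (C z y)) * ennreal (cmod (B w z)))
          \<le> beurling_norm V E d r \<alpha> C * (\<Sum>\<^sub>\<infinity>z\<in>V. ennreal (cmod (B w z)))"
        using True by (intro infsum_mult_le entry_le_beurling_norm r) auto
      also have "\<dots> \<le> beurling_norm V E d r \<alpha> C * schur_norm V B"
        using \<open>w \<in> V\<close> by (intro mult_left_mono schur_norm_row) auto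
      finally show "(\<Sum>\<^sub>\<infinity>z\<in>V. ennreal (cmod (C z y)) * ennreal (cmod (B w z)))
          \<le> beurling_norm V E d r \<alpha> C * schur_norm V B" .
    qed simp
    also have "\<dots> = beurling_norm V E d r \<alpha> C * schur_norm V B * (\<Sum>\<^sub>\<infinity>w\<in>V. ennreal (cmod (A x w)))"
      by (simp add: mult.commute[of "ennreal _"] infsum_cmult_ennreal)
    also have "\<dots> \<le> beurling_norm V E d r \<alpha> C * schur_norm V B * schur_norm V A"
      using True by (intro mult_left_mono schur_norm_row) auto
    also have "\<dots> < top"
      using assms norm_finite schur_norm_finite by (simp add: ennreal_mult_less_top)
    finally have "(\<lambda>(w, z). ?f w z) summable_on V \<times> V"
      by (intro abs_summable_summable[OF abs_summable_on_if_ennreal]) (simp add: case_prod_unfold)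
    then have "(\<Sum>\<^sub>\<infinity>w\<in>V. \<Sum>\<^sub>\<infinity>z\<in>V. ?f w z) = (\<Sum>\<^sub>\<infinity>z\<in>V. \<Sum>\<^sub>\<infinity>w\<in>V. ?f w z)"
      by (rule infsum_swap_banach)
    then show ?thesis
      by (simp add: mat_mult_def mult.assoc flip: infsum_cmult_left' infsum_cmult_right')
  next
    case False
    then have "mat_mult V (mat_mult V A B) C x y = 0" "mat_mult V A (mat_mult V B C) x y = 0"
      using assms by (auto intro!: entry_zero mult_closed)
    then show ?thesis by simp
  qed
qed

lemma nrm_eq_0_iff:
  assumes "A \<in> \<A>"
  shows "nrm A = 0 \<longleftrightarrow> A = 0"
proof
  assume "nrm A = 0"
  then have "beurling_norm V E d r \<alpha> A = 0"
    using ennreal_nrm[OF assms] by simp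
  then have "A x y = 0" for x y
    using entry_le_beurling_norm[OF r, of x y A \<alpha>] entry_zero[OF assms, of x y]
    by (cases "x \<in> V \<and> y \<in> V") auto
  then show "A = 0" by (simp add: fun_eq_iff)
next
  assume "A = 0"
  then show "nrm A = 0"
    using beurling_norm_mat_scale[OF r, of \<alpha> 0 0] by (simp add: mat_scale_def zero_fun_def)
qed

lemma nrm_add_le:
  assumes "A \<in> \<A>" "B \<in> \<A>"
  shows "nrm (A + B) \<le> nrm A + nrm B"
proof -
  have "ennreal (nrm (A + B)) \<le> ennreal (nrm A) + ennreal (nrm B)"
    using beurling_norm_add_le[OF r] assms by (simp add: ennreal_nrm add_closed)
  then show ?thesis by (simp flip: ennreal_plus)
qed

lemma nrm_mult_le:
  assumes "A \<in> \<A>" "B \<in> \<A>"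
  shows "nrm (mat_mult V A B) \<le> (2 powr (\<alpha> + 1 + d * recip r) * d * D * algebra_const r \<alpha>) * nrm A * nrm B"
    (is "_ \<le> ?K * _ * _")
proof -
  have K: "0 \<le> ?K" using d_pos D_pos by (simp add: algebra_const_def)
  have "ennreal (nrm (mat_mult V A B)) \<le> ennreal ?K * ennreal (nrm A) * ennreal (nrm B)"
    using order_trans[OF beurling_norm_mat_mult_le[OF r \<alpha>(1)] schur_sum_le[OF r \<alpha>(2)]] assms
    by (simp add: ennreal_nrm mult_closed)
  also have "\<dots> = ennreal (?K * nrm A * nrm B)"
    using K by (simp add: ennreal_mult)
  finally show ?thesis using K by simp
qed

lemma metric_space_class: "Metric_space \<A> (\<lambda>A B. nrm (A - B))"
proof
  fix A B C
  show "nrm (A - B) = nrm (B - A)"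
    using beurling_norm_minus_commute[OF r, of \<alpha> A B] by simp
  assume AB: "A \<in> \<A>" "B \<in> \<A>"
  then show "nrm (A - B) = 0 \<longleftrightarrow> A = B"
    using nrm_eq_0_iff[OF diff_closed[OF AB]] by simp
  assume "C \<in> \<A>"
  then show "nrm (A - C) \<le> nrm (A - B) + nrm (B - C)"
    using nrm_add_le[of "A - B" "B - C"] AB by (simp add: diff_closed)
qed simp

text \<open>The norm dominates entries, so a Cauchy sequence has an entrywise limit L; lower
  semicontinuity upgrades this to convergence in norm.\<close>

lemma mcomplete_class: "Metric_space.mcomplete \<A> (\<lambda>A B. nrm (A - B))"
proof -
  interpret Metric_space \<A> "\<lambda>A B. nrm (A - B)" by (rule metric_space_class)
  show ?thesis
    unfolding mcomplete_def
  proof (intro allI impI)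
    fix \<sigma> assume \<sigma>: "MCauchy \<sigma>"
    then have \<sigma>_in: "\<sigma> n \<in> \<A>" for n by (auto simp: MCauchy_def)
    have Cauchy: "\<exists>N. \<forall>n\<ge>N. \<forall>m\<ge>N. nrm (\<sigma> n - \<sigma> m) < e" if "0 < e" for e
      using \<sigma> that unfolding MCauchy_def by meson
    have "\<exists>a. (\<lambda>n. \<sigma> n x y) \<longlonglongrightarrow> a" for x y
    proof (cases "x \<in> V \<and> y \<in> V")
      case True
      have le: "cmod (\<sigma> n x y - \<sigma> m x y) \<le> nrm (\<sigma> n - \<sigma> m)" for n m
      proof -
        have "ennreal (cmod ((\<sigma> n - \<sigma> m) x y)) \<le> ennreal (nrm (\<sigma> n - \<sigma> m))"
          unfolding ennreal_nrm[OF diff_closed[OF \<sigma>_in \<sigma>_in]]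
          using True by (intro entry_le_beurling_norm r) auto
        then show ?thesis by simp
      qed
      have "Cauchy (\<lambda>n. \<sigma> n x y)"
      proof (rule CauchyI)
        fix e :: real assume "0 < e"
        then obtain N where "\<forall>n\<ge>N. \<forall>m\<ge>N. nrm (\<sigma> n - \<sigma> m) < e" using Cauchy by blast
        then show "\<exists>N. \<forall>m\<ge>N. \<forall>n\<ge>N. cmod (\<sigma> m x y - \<sigma> n x y) < e"
          using le_less_trans[OF le] by blast
      qed
      then show ?thesis by (simp add: Cauchy_convergent_iff convergent_def)
    next
      case False
      then have "\<sigma> n x y = 0" for n using entry_zero[OF \<sigma>_in] by auto
      then show ?thesis by auto
    qed
    then obtain L where L: "(\<lambda>n. \<sigma> n x y) \<longlonglongrightarrow> L x y" for x y by metis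
    \<comment> \<open>With n fixed, the differences of \<open>\<sigma> n\<close> and the later terms
      converge entrywise to \<open>\<sigma> n - L\<close> and have norm at most e. The limit
      preserves only the weak inequality.\<close>
    have close: "beurling_norm V E d r \<alpha> (\<sigma> n - L) \<le> ennreal e"
      if "\<And>n m. N \<le> n \<Longrightarrow> N \<le> m \<Longrightarrow> nrm (\<sigma> n - \<sigma> m) < e" "N \<le> n" for N n e
    proof (rule beurling_norm_lim_le[OF r])
      show "(\<lambda>k. (\<sigma> n - \<sigma> (k + N)) x y) \<longlonglongrightarrow> (\<sigma> n - L) x y" for x y
        using LIMSEQ_ignore_initial_segment[OF L] by (auto intro!: tendsto_intros)
      have "nrm (\<sigma> n - \<sigma> (k + N)) \<le> e" for k
        using that(1)[of n "k + N"] that(2) by simp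
      then show "beurling_norm V E d r \<alpha> (\<sigma> n - \<sigma> (k + N)) \<le> ennreal e" for k
        by (subst ennreal_nrm[OF diff_closed[OF \<sigma>_in \<sigma>_in], symmetric]) (rule ennreal_leI)
    qed
    have L_matrix: "L \<in> matrices V"
    proof -
      have "L x y = 0" if "x \<notin> V \<or> y \<notin> V" for x y
      proof -
        have "\<sigma> n x y = 0" for n using entry_zero[OF \<sigma>_in that] .
        then show ?thesis using L[of x y] by (simp add: LIMSEQ_const_iff)
      qed
      then show ?thesis by (simp add: matrices_def)
    qed
    obtain N1 where N1: "\<And>n m. N1 \<le> n \<Longrightarrow> N1 \<le> m \<Longrightarrow> nrm (\<sigma> n - \<sigma> m) < 1"
      using Cauchy[of 1] by auto
    \<comment> \<open>Membership of L is obtained indirectly: its difference from one term has norm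
      at most 1, and the class is closed under differences.\<close>
    have "\<sigma> N1 - L \<in> \<A>"
      using le_less_trans[OF close[OF N1 order_refl] ennreal_less_top] L_matrix class_matrices[OF \<sigma>_in, of N1]
      by (auto simp: beurling_class_def matrices_def)
    from diff_closed[OF \<sigma>_in this, of N1] have L_in: "L \<in> \<A>" by simp
    have "limitin mtopology \<sigma> L sequentially"
      unfolding limit_metric_sequentially
    proof (intro conjI allI impI L_in)
      fix e :: real assume "0 < e"
      then obtain N where N: "\<And>n m. N \<le> n \<Longrightarrow> N \<le> m \<Longrightarrow> nrm (\<sigma> n - \<sigma> m) < e / 2"
        using Cauchy[of "e / 2"] by auto
      have "nrm (\<sigma> n - L) < e" if "N \<le> n" for n
      proof -
        have "nrm (\<sigma> n - L) \<le> e / 2"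
          using close[OF N that] \<open>0 < e\<close> by (intro enn2real_leI) auto
        then show ?thesis using \<open>0 < e\<close> by simp
      qed
      then show "\<exists>N. \<forall>n\<ge>N. \<sigma> n \<in> \<A> \<and> nrm (\<sigma> n - L) < e"
        using \<sigma>_in by blast
    qed
    then show "\<exists>L. limitin mtopology \<sigma> L sequentially" by blast
  qed
qed

lemma banach_algebra_class: "banach_algebra_on \<A> mat_scale (mat_mult V) (\<lambda>A. nrm A)"
proof -
  have "mat_mult V (A + B) C = mat_mult V A C + mat_mult V B C"
    "mat_mult V A (B + C) = mat_mult V A B + mat_mult V A C"
    if "A \<in> \<A>" "B \<in> \<A>" "C \<in> \<A>" for A B C
    \<comment> \<open>Distributivity is where convergence of the entry sums enters; compatibility
      with scalars holds for \<open>infsum\<close> in general.\<close>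
    using that by (auto simp: mat_mult_def fun_eq_iff distrib_left distrib_right infsum_add mult_summable)
  moreover have "mat_mult V (mat_scale t A) B = mat_scale t (mat_mult V A B)"
    "mat_mult V A (mat_scale t B) = mat_scale t (mat_mult V A B)" for t A B
    by (auto simp: mat_mult_def mat_scale_def fun_eq_iff mult.assoc mult.left_commute[of _ t] infsum_cmult_right')
  moreover have "nrm (mat_scale t A) = cmod t * nrm A" for t A
    by (simp add: beurling_norm_mat_scale[OF r] enn2real_mult)
  ultimately show ?thesis
    unfolding banach_algebra_on_def
    using vector_space_mat_scale subspace_class mult_closed mult_assoc nrm_eq_0_iff nrm_add_le
      mcomplete_class nrm_mult_le by (intro conjI exI ballI allI) auto
qed

end

end

theorem proposition3p1:
  fixes V :: "'v set" and E :: "('v \<times> 'v) set"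
    and d D1 \<alpha> :: real and q r :: ennreal
  assumes "simple_graph V E" and "connected_graph V E"
    and "beurling_dimension V E d" and "beurling_density V E d D1"
    and "1 \<le> q" and "1 \<le> r" and "0 \<le> \<alpha>"
  shows
    "(beurling_class V E d 1 0 \<subseteq> schur_class V \<and> schur_class V \<subseteq> bounded_op_matrices V q \<and>
      (\<forall>A\<in>beurling_class V E d 1 0.
         op_norm V q (mat_op V A) \<le> schur_norm V A \<and>
         schur_norm V A \<le> ennreal (d * D1) * beurling_norm V E d 1 0 A))
     \<and>
     (\<forall>r'' \<gamma> \<beta>. r \<le> r'' \<and> \<alpha> \<le> \<gamma> \<and> \<gamma> + d * (recip r - recip r'') < \<beta> \<longrightarrow>
        beurling_class V E d r'' \<beta> \<subseteq> beurling_class V E d r \<gamma> \<and>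
        beurling_class V E d r \<gamma> \<subseteq> beurling_class V E d r \<alpha> \<and>
        beurling_class V E d r \<alpha> \<subseteq> beurling_class V E d r'' \<alpha> \<and>
        (\<forall>A\<in>beurling_class V E d r'' \<beta>.
           beurling_norm V E d r'' \<alpha> A \<le> beurling_norm V E d r \<alpha> A \<and>
           beurling_norm V E d r \<alpha> A \<le> beurling_norm V E d r \<gamma> A \<and>
           beurling_norm V E d r \<gamma> A \<le>
             ennreal (((\<beta> - \<gamma> - (d - 1) * (recip r - recip r'')) /
                       (\<beta> - \<gamma> - d * (recip r - recip r''))) powr (recip r - recip r''))
             * beurling_norm V E d r'' \<beta> A))
     \<and>
     (d * (1 - recip r) < \<alpha> \<longrightarrow>
        (\<forall>A\<in>beurling_class V E d r \<alpha>. \<forall>B\<in>beurling_class V E d r \<alpha>.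
           \<forall>x\<in>V. \<forall>y\<in>V. (\<lambda>z. A x z * B z y) summable_on V) \<and>
        banach_algebra_on (beurling_class V E d r \<alpha>) mat_scale (mat_mult V)
          (\<lambda>A. enn2real (beurling_norm V E d r \<alpha> A)) \<and>
        (\<forall>A\<in>beurling_class V E d r \<alpha>. \<forall>B\<in>beurling_class V E d r \<alpha>.
           beurling_norm V E d r \<alpha> (mat_mult V A B) \<le>
             ennreal (2 powr (\<alpha> + d * recip r)) *
               (schur_norm V B * beurling_norm V E d r \<alpha> A
                + schur_norm V A * beurling_norm V E d r \<alpha> B) \<and>
           ennreal (2 powr (\<alpha> + d * recip r)) *
               (schur_norm V B * beurling_norm V E d r \<alpha> A
                + schur_norm V A * beurling_norm V E d r \<alpha> B) \<le>
             ennreal (2 powr (\<alpha> + 1 + d * recip r) * d * D1 *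
                      ((\<alpha> - (d - 1) * (1 - recip r)) / (\<alpha> - d * (1 - recip r)))
                        powr (1 - recip r))
             * beurling_norm V E d r \<alpha> A * beurling_norm V E d r \<alpha> B))
     \<and>
     (\<forall>A\<in>matrices V. \<forall>B\<in>matrices V.
        (\<forall>x\<in>V. \<forall>y\<in>V. cmod (A x y) \<le> cmod (B x y)) \<longrightarrow>
        beurling_norm V E d r \<alpha> A \<le> beurling_norm V E d r \<alpha> B)"
proof -
  interpret beurling_graph V E d D1
    using assms by unfold_locales auto
  note q = \<open>1 \<le> q\<close> and r = \<open>1 \<le> r\<close> and \<alpha> = \<open>0 \<le> \<alpha>\<close>
  have "beurling_class V E d 1 0 \<subseteq> schur_class V"
  proof
    fix A assume A: "A \<in> beurling_class V E d 1 0"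
    then have "ennreal (d * D1) * beurling_norm V E d 1 0 A < top"
      by (simp add: beurling_class_def ennreal_mult_less_top)
    then show "A \<in> schur_class V"
      using A le_less_trans[OF schur_norm_le[of A]] by (simp add: beurling_class_def schur_class_def)
  qed
  moreover have "schur_class V \<subseteq> bounded_op_matrices V q"
    using schur_subset_bounded_op_matrices[OF q] by blast
  ultimately have i: "beurling_class V E d 1 0 \<subseteq> schur_class V \<and> schur_class V \<subseteq> bounded_op_matrices V q \<and>
      (\<forall>A\<in>beurling_class V E d 1 0.
         op_norm V q (mat_op V A) \<le> schur_norm V A \<and>
         schur_norm V A \<le> ennreal (d * D1) * beurling_norm V E d 1 0 A)"
    using op_norm_le_schur_norm[OF q] schur_norm_le by blast
  have ii: "beurling_class V E d r'' \<beta> \<subseteq> beurling_class V E d r \<gamma> \<and>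
        beurling_class V E d r \<gamma> \<subseteq> beurling_class V E d r \<alpha> \<and>
        beurling_class V E d r \<alpha> \<subseteq> beurling_class V E d r'' \<alpha> \<and>
        (\<forall>A\<in>beurling_class V E d r'' \<beta>.
           beurling_norm V E d r'' \<alpha> A \<le> beurling_norm V E d r \<alpha> A \<and>
           beurling_norm V E d r \<alpha> A \<le> beurling_norm V E d r \<gamma> A \<and>
           beurling_norm V E d r \<gamma> A \<le>
             ennreal (((\<beta> - \<gamma> - (d - 1) * (recip r - recip r'')) /
                       (\<beta> - \<gamma> - d * (recip r - recip r''))) powr (recip r - recip r''))
             * beurling_norm V E d r'' \<beta> A)"
    if h: "r \<le> r''" "\<alpha> \<le> \<gamma>" "\<gamma> + d * (recip r - recip r'') < \<beta>" for r'' \<gamma> \<beta>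
  proof -
    let ?C = "ennreal (((\<beta> - \<gamma> - (d - 1) * (recip r - recip r'')) /
                       (\<beta> - \<gamma> - d * (recip r - recip r''))) powr (recip r - recip r''))"
    have le1: "beurling_norm V E d r'' \<alpha> A \<le> beurling_norm V E d r \<alpha> A" for A
      unfolding beurling_norm_eq_seq_norm by (rule seq_norm_antimono_exponent[OF r h(1) one_le_d])
    have le2: "beurling_norm V E d r \<alpha> A \<le> beurling_norm V E d r \<gamma> A" for A
      by (rule beurling_norm_mono[OF r h(2)]) simp
    have le3: "beurling_norm V E d r \<gamma> A \<le> ?C * beurling_norm V E d r'' \<beta> A" for A
      unfolding beurling_norm_eq_seq_norm by (rule seq_norm_embedding[OF r h(1,3)])
    have "beurling_norm V E d r \<gamma> A < top" if "beurling_norm V E d r'' \<beta> A < top" for A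
      using that by (intro le_less_trans[OF le3]) (simp add: ennreal_mult_less_top)
    then have "beurling_class V E d r'' \<beta> \<subseteq> beurling_class V E d r \<gamma>"
      unfolding beurling_class_def by auto
    moreover have "beurling_class V E d r \<gamma> \<subseteq> beurling_class V E d r \<alpha>"
      unfolding beurling_class_def using le_less_trans[OF le2] by auto
    moreover have "beurling_class V E d r \<alpha> \<subseteq> beurling_class V E d r'' \<alpha>"
      unfolding beurling_class_def using le_less_trans[OF le1] by auto
    ultimately show ?thesis using le1 le2 le3 by blast
  qed
  have iii: "(\<forall>A\<in>beurling_class V E d r \<alpha>. \<forall>B\<in>beurling_class V E d r \<alpha>.
           \<forall>x\<in>V. \<forall>y\<in>V. (\<lambda>z. A x z * B z y) summable_on V) \<and>
        banach_algebra_on (beurling_class V E d r \<alpha>) mat_scale (mat_mult V)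
          (\<lambda>A. enn2real (beurling_norm V E d r \<alpha> A)) \<and>
        (\<forall>A\<in>beurling_class V E d r \<alpha>. \<forall>B\<in>beurling_class V E d r \<alpha>.
           beurling_norm V E d r \<alpha> (mat_mult V A B) \<le>
             ennreal (2 powr (\<alpha> + d * recip r)) *
               (schur_norm V B * beurling_norm V E d r \<alpha> A
                + schur_norm V A * beurling_norm V E d r \<alpha> B) \<and>
           ennreal (2 powr (\<alpha> + d * recip r)) *
               (schur_norm V B * beurling_norm V E d r \<alpha> A
                + schur_norm V A * beurling_norm V E d r \<alpha> B) \<le>
             ennreal (2 powr (\<alpha> + 1 + d * recip r) * d * D1 *
                      ((\<alpha> - (d - 1) * (1 - recip r)) / (\<alpha> - d * (1 - recip r)))
                        powr (1 - recip r))
             * beurling_norm V E d r \<alpha> A * beurling_norm V E d r \<alpha> B)"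
    if large: "d * (1 - recip r) < \<alpha>"
    using mult_summable[OF r \<alpha> large] banach_algebra_class[OF r \<alpha> large]
      beurling_norm_mat_mult_le[OF r \<alpha>] schur_sum_le[OF r large, unfolded algebra_const_def]
    by blast
  have iv: "beurling_norm V E d r \<alpha> A \<le> beurling_norm V E d r \<alpha> B"
    if "\<forall>x\<in>V. \<forall>y\<in>V. cmod (A x y) \<le> cmod (B x y)" for A B
    using that by (intro beurling_norm_mono r order_refl) blast
  show ?thesis
    using i ii iii iv by blast
qed

end
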